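(* Let $r\ge1$ and $d\ge0$ be integers. The limit as $n\to\infty$ of the probability that node $r$ in a random noncrossing tree with $n$ edges has depth $d$ exists. Denoting this limit by $p_{r,d}$, we have $$\sum_{r\ge1}\sum_{d\ge0} p_{r,d}\, x^r y^d=\frac{P_2(x,y)\,T\!\left(\tfrac{4x}{27}\right)^2+P_1(x,y)\, T\!\left(\tfrac{4x}{27}\right)+P_0(x,y)}{\left(\dfrac{y^2(3-y)}{2}-\dfrac{x}{2}\left(4-12 y+ 15y^2-3y^3 \right)+x^2y^3 \right)^2},$$ where \begin{align*} P_2(x,y)&=\frac{1}{9}x^2y(1-y)\left(12y^2 - 5y^3 + y^4 + x(16- 44y+ 36y^2 - 27y^3 + 3y^4) + 4x^2y^3(1+y)\right),\\ P_1(x,y)&=x^2y^2(1-y)^2(2-y)\left(4-y-x(2+y)\right),\\ P_0(x,y)&=xy^2(1-xy)\left(y^3 - x(8- 18y + 12y^2) + x^2y^3\right). \end{align*}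
   Context: A noncrossing tree with $n$ edges is a tree whose $n+1$ nodes are points on the boundary of a circle, labeled $0,1,\dots,n$ in counterclockwise order around the circle, and whose edges are straight segments that do not cross. It is regarded as rooted at node $0$. The depth of a node is the number of edges in the path from node $0$ to it. A random noncrossing tree with $n$ edges is chosen uniformly among all $\frac{1}{2n+1}\binom{3n}{n}$ of them (with $n\ge r$). $T$ denotes the power series $T(z)=\sum_{n\ge0}\frac{1}{2n+1}\binom{3n}{n}z^n$, which satisfies $T(z)-1=zT(z)^3$. The right-hand side is expanded as a power series in $x$ whose coefficients are rational functions of $y$, which are in turn expanded as power series at $y=0$. *)

theory Defs
  imports
    "HOL-Probability.Probability"
    "HOL-Computational_Algebra.Formal_Laurent_Series"
begin

section \<open>Trees\<close>

text \<open>Undirected graphs on a vertex set \<open>V\<close> are given by their set \<open>E\<close> of edges, each edge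
  being a two-element set of vertices. A path is given by its list of (distinct) vertices, a cycle
  by its list of distinct vertices, the last one being joined to the first one.\<close>

definition is_path :: "'a set \<Rightarrow> 'a set set \<Rightarrow> 'a \<Rightarrow> 'a \<Rightarrow> 'a list \<Rightarrow> bool" where
  "is_path V E u v p \<longleftrightarrow>
     p \<noteq> [] \<and> hd p = u \<and> last p = v \<and> set p \<subseteq> V \<and> distinct p \<and>
     successively (\<lambda>a b. {a, b} \<in> E) p"

definition is_cycle :: "'a set set \<Rightarrow> 'a list \<Rightarrow> bool" where
  "is_cycle E c \<longleftrightarrow>
     length c \<ge> 3 \<and> distinct c \<and> successively (\<lambda>a b. {a, b} \<in> E) c \<and> {last c, hd c} \<in> E"

definition is_tree :: "'a set \<Rightarrow> 'a set set \<Rightarrow> bool" where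
  "is_tree V E \<longleftrightarrow>
     V \<noteq> {} \<and>
     (\<forall>e\<in>E. \<exists>a\<in>V. \<exists>b\<in>V. a \<noteq> b \<and> e = {a, b}) \<and>
     (\<forall>u\<in>V. \<forall>v\<in>V. \<exists>p. is_path V E u v p) \<and>
     (\<nexists>c. is_cycle E c)"

section \<open>Noncrossing trees\<close>

text \<open>The \<open>n + 1\<close> nodes are placed at the vertices of a regular \<open>(n + 1)\<close>-gon. Which chords
  cross depends only on the cyclic order of the nodes, so the choice of positions is immaterial.\<close>

definition node_pos :: "nat \<Rightarrow> nat \<Rightarrow> complex" where
  "node_pos n k = cis (2 * pi * real k / real (n + 1))"

text \<open>Open segments are used because two edges may share an endpoint without crossing.\<close>

definition noncrossing :: "nat \<Rightarrow> nat set set \<Rightarrow> bool" where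
  "noncrossing n E \<longleftrightarrow>
     (\<forall>a b c d. {a, b} \<in> E \<and> {c, d} \<in> E \<and> {a, b} \<noteq> {c, d} \<longrightarrow>
        open_segment (node_pos n a) (node_pos n b) \<inter>
        open_segment (node_pos n c) (node_pos n d) = {})"

definition noncrossing_trees :: "nat \<Rightarrow> nat set set set" where
  "noncrossing_trees n = {E. is_tree {0..n} E \<and> noncrossing n E}"

definition depth :: "nat \<Rightarrow> nat set set \<Rightarrow> nat \<Rightarrow> nat" where
  "depth n E v = (THE k. \<exists>p. is_path {0..n} E 0 v p \<and> length p = k + 1)"

text \<open>The value is meaningful only for \<open>r \<le> n\<close>, which does not matter for the limit.\<close>

definition depth_prob :: "nat \<Rightarrow> nat \<Rightarrow> nat \<Rightarrow> real" where
  "depth_prob n r d = measure_pmf.prob (pmf_of_set (noncrossing_trees n)) {E. depth n E r = d}"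

definition limit_prob :: "nat \<Rightarrow> nat \<Rightarrow> real" where
  "limit_prob r d = lim (\<lambda>n. depth_prob n r d)"

section \<open>Generating functions\<close>

definition T_series :: "'a :: field_char_0 fps" where
  "T_series = Abs_fps (\<lambda>n. of_nat ((3 * n) choose n) / of_nat (2 * n + 1))"

definition P2 :: "'a :: {comm_ring_1, inverse} \<Rightarrow> 'a \<Rightarrow> 'a" where
  "P2 x y = 1 / 9 * x^2 * y * (1 - y) *
     (12 * y^2 - 5 * y^3 + y^4
      + x * (16 - 44 * y + 36 * y^2 - 27 * y^3 + 3 * y^4)
      + 4 * x^2 * y^3 * (1 + y))"

definition P1 :: "'a :: {comm_ring_1, inverse} \<Rightarrow> 'a \<Rightarrow> 'a" where
  "P1 x y = x^2 * y^2 * (1 - y)^2 * (2 - y) * (4 - y - x * (2 + y))"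

definition P0 :: "'a :: {comm_ring_1, inverse} \<Rightarrow> 'a \<Rightarrow> 'a" where
  "P0 x y = x * y^2 * (1 - x * y) * (y^3 - x * (8 - 18 * y + 12 * y^2) + x^2 * y^3)"

text \<open>Bivariate series are elements of \<open>real fls fps\<close>: power series in \<open>x\<close> whose coefficients
  are Laurent series in \<open>y\<close>. Expanding rational functions of \<open>y\<close> at \<open>y = 0\<close> embeds the field they
  form into \<open>real fls\<close>, so a division here first expands in powers of \<open>x\<close> over the rational functions
  of \<open>y\<close> and then expands each coefficient at \<open>y = 0\<close>. Laurent series are needed because
  the denominator of the formula, at \<open>x = 0\<close>, is a multiple of \<open>y^4\<close> and hence not invertible
  as a power series in \<open>y\<close>.\<close>

definition var_x :: "real fls fps" where
  "var_x = fps_X"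

definition var_y :: "real fls fps" where
  "var_y = fps_const fls_X"

text \<open>The series \<open>\<Sum>\<^sub>r\<^sub>\<ge>\<^sub>1 \<Sum>\<^sub>d\<^sub>\<ge>\<^sub>0 p r d x^r y^d\<close>.\<close>

definition bivariate_gf :: "(nat \<Rightarrow> nat \<Rightarrow> real) \<Rightarrow> real fls fps" where
  "bivariate_gf p =
     Abs_fps (\<lambda>r. if r \<ge> 1 then fps_to_fls (Abs_fps (\<lambda>d. p r d)) else 0)"

end

theory Submission
  imports Defs "HOL-Library.Transitive_Closure_Table" "HOL-Real_Asymp.Real_Asymp"
begin

text \<open>
Let \<open>c\<close> be the largest neighbour of the root of a noncrossing tree with at least one edge. Deleting
the edge from \<open>0\<close> to \<open>c\<close> leaves two components, and since nothing crosses this edge and the components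
do not cross each other, they occupy intervals \<open>[0, s]\<close> and \<open>[s + 1, n]\<close>; the second one splits at \<open>c\<close>
into a tree on \<open>[s + 1, c]\<close> and a tree on \<open>[c, n]\<close>. The three pieces are arbitrary
(\<open>sum_noncrossing_trees_Suc\<close>), so the counting series \<open>T(z)\<close> satisfies \<open>T = 1 + z T^3\<close>. Nodes of the first
piece keep their depth, and for the others the depth is one more than the distance to \<open>c\<close>.

Let \<open>D d\<close> be the sum of \<open>z^n x^v\<close> over all trees and all their nodes \<open>v\<close> of depth \<open>d\<close>, let \<open>L d\<close> be the
same with \<open>x^(n - v)\<close>, and put \<open>t = T(z x)\<close>. In the piece on \<open>[s + 1, c]\<close> the root is the last node, so the
decomposition couples the two families. Solving the recurrences gives \<open>D 1 = z x t^2 T^2\<close> and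
\<open>D (d + 1) = z t T (T + x t) D d\<close> (\<open>depth_gf_rec\<close>). For a fixed power of \<open>x\<close>, the coefficient in \<open>D d\<close> is
therefore a polynomial in \<open>z\<close> and \<open>T(z)\<close>.

The coefficients of powers of \<open>T\<close> are explicit, and \<open>[z^n] z^k T^m / [z^n] T\<close> tends to
\<open>(4/27)^k m (3/2)^(m - 1)\<close>. This is the derivative of \<open>z^k T^m\<close> with respect to \<open>T\<close> at the singularity
\<open>z = 4/27\<close>, \<open>T = 3/2\<close>. Hence the limit of the ratios is computed by the substitution
\<open>z = 4/27\<close>, \<open>T = 3/2 + \<epsilon>\<close> with \<open>\<epsilon>^2 = 0\<close>, and its \<open>\<epsilon>\<close>-part obeys the product rule
(\<open>dual_value_mult\<close>, \<open>dual_value_tendsto\<close>). Under this substitution the recurrence for \<open>D\<close> becomes a linear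
recurrence for the limit probabilities. Summing it over \<open>d\<close>, and now writing \<open>t\<close> for \<open>T(4x/27)\<close>, one finds
the limit series

\<open>G = (4/9) x y t^2 (1 - x y t^2 / 9) / (1 - y t / 3 - 2 x y t^2 / 9)^2\<close>.

Finally \<open>4 x t^3 = 27 (t - 1)\<close> is used to remove \<open>t\<close> from the denominator (\<open>rationalised_form\<close>).
\<close>

section \<open>Crossing chords of a regular polygon\<close>

text \<open>Twice the signed area of a triangle. As a function of its third corner it is affine and
vanishes on the line through the other two, so its sign tells the side of a chord.\<close>

definition orient :: "complex \<Rightarrow> complex \<Rightarrow> complex \<Rightarrow> real" where
  "orient a b c = (Re b - Re a) * (Im c - Im a) - (Im b - Im a) * (Re c - Re a)"

lemma orient_cis_pos:
  assumes "\<alpha> < \<beta>" "\<beta> < \<gamma>" "\<gamma> < \<alpha> + 2 * pi"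
  shows "orient (cis \<alpha>) (cis \<beta>) (cis \<gamma>) > 0"
proof -
  define u v where "u = (\<beta> - \<alpha>) / 2" and "v = (\<gamma> - \<beta>) / 2"
  have b: "\<beta> = \<alpha> + 2 * u" and c: "\<gamma> = \<alpha> + 2 * (u + v)"
    by (auto simp: u_def v_def field_simps)
  have "orient (cis \<alpha>) (cis \<beta>) (cis \<gamma>) = sin (\<beta> - \<alpha>) + sin (\<gamma> - \<beta>) - sin (\<gamma> - \<alpha>)"
    by (simp add: orient_def sin_diff algebra_simps)
  also have "\<dots> = sin (2 * u) + sin (2 * v) - sin (2 * u + 2 * v)"
    by (simp add: b c algebra_simps)
  also have "\<dots> = sin (2 * u) * (1 - cos (2 * v)) + sin (2 * v) * (1 - cos (2 * u))"
    by (simp add: sin_add algebra_simps)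
  also have "\<dots> = 4 * sin u * sin v * sin (u + v)"
    unfolding sin_double cos_double_sin sin_add by (simp add: power2_eq_square algebra_simps)
  also have "\<dots> > 0"
    using assms by (intro mult_pos_pos sin_gt_zero) (auto simp: u_def v_def field_simps)
  finally show ?thesis .
qed

lemma orient_node_pos:
  assumes "a < b" "b < c" "c \<le> n"
  shows "orient (node_pos n a) (node_pos n b) (node_pos n c) > 0"
  unfolding node_pos_def
proof (rule orient_cis_pos)
  have "real c < real a + real (n + 1)" using assms by linarith
  hence "2 * pi * real c < 2 * pi * real a + 2 * pi * real (n + 1)"
    by (simp add: distrib_left[symmetric] del: of_nat_add)
  hence "2 * pi * real c / real (n + 1) < (2 * pi * real a + 2 * pi * real (n + 1)) / real (n + 1)"
    by (rule divide_strict_right_mono) simp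
  thus "2 * pi * real c / real (n + 1) < 2 * pi * real a / real (n + 1) + 2 * pi"
    by (simp add: add_divide_distrib del: of_nat_add)
qed (use assms in \<open>auto intro!: divide_strict_right_mono mult_strict_left_mono simp del: of_nat_add\<close>)

lemma orient_rotate: "orient b c a = orient a b c"
  by (simp add: orient_def algebra_simps)

lemma orient_swap: "orient a c b = - orient a b c"
  by (simp add: orient_def algebra_simps)

lemma orient_convex:
  "orient a b ((1 - s) *\<^sub>R p + s *\<^sub>R q) = (1 - s) * orient a b p + s * orient a b q"
  by (simp add: orient_def algebra_simps)

text \<open>The four areas are the coefficients of an affine dependency between four points of the plane;
collecting the terms of \<open>a\<close>, \<open>c\<close> on one side and those of \<open>b\<close>, \<open>d\<close> on the other exhibits a common
point of the two diagonals.\<close>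

lemma crossing_segments_meet:
  assumes "orient b c d > 0" "orient a c d > 0" "orient a b d > 0" "orient a b c > 0"
  shows "open_segment a c \<inter> open_segment b d \<noteq> {}"
proof -
  have "a \<noteq> c" "b \<noteq> d"
    using assms by (auto simp: orient_def)
  define S where "S = orient b c d + orient a b d"
  have S: "S = orient a c d + orient a b c"
    by (simp add: S_def orient_def algebra_simps)
  have S0: "S > 0" using assms by (simp add: S_def)
  define p where "p = (1 - orient a b d / S) *\<^sub>R a + (orient a b d / S) *\<^sub>R c"
  define q where "q = (1 - orient a b c / S) *\<^sub>R b + (orient a b c / S) *\<^sub>R d"
  have 1: "1 - orient a b d / S = orient b c d / S"
    using S0 by (simp add: S_def field_simps)
  have 2: "1 - orient a b c / S = orient a c d / S"
    using S0 by (simp add: S field_simps)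
  have "S *\<^sub>R p = S *\<^sub>R q"
  proof -
    have "S *\<^sub>R p = orient b c d *\<^sub>R a + orient a b d *\<^sub>R c"
      unfolding p_def 1 scaleR_add_right scaleR_scaleR using S0 by simp
    also have "\<dots> = orient a c d *\<^sub>R b + orient a b c *\<^sub>R d"
      by (simp add: complex_eq_iff orient_def algebra_simps)
    also have "\<dots> = S *\<^sub>R q"
      unfolding q_def 2 scaleR_add_right scaleR_scaleR using S0 by simp
    finally show ?thesis .
  qed
  hence "p = q" using S0 by simp
  moreover have "p \<in> open_segment a c"
    using assms S0 \<open>a \<noteq> c\<close> \<open>b \<noteq> d\<close> by (auto simp: in_segment p_def S_def intro!: exI[of _ "orient a b d / S"])
  moreover have "q \<in> open_segment b d"
    using assms S0 \<open>a \<noteq> c\<close> \<open>b \<noteq> d\<close> by (auto simp: in_segment q_def S intro!: exI[of _ "orient a b c / S"])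
  ultimately show ?thesis by auto
qed

lemma orient_on_segment:
  assumes "p \<in> open_segment a b"
  shows "orient a b p = 0"
proof -
  obtain u where "p = (1 - u) *\<^sub>R a + u *\<^sub>R b" using assms by (auto simp: in_segment)
  thus ?thesis by (simp add: orient_convex) (simp add: orient_def)
qed

text \<open>The factor \<open>\<sigma>\<close> is used with the values \<open>1\<close> and \<open>- 1\<close>, one for each side of the line through \<open>a\<close> and
\<open>b\<close>. One endpoint may lie on this line, which covers chords with a common endpoint.\<close>

lemma segments_disjoint_if_same_side:
  assumes "(\<sigma>::real) * orient a b c \<ge> 0" "\<sigma> * orient a b d \<ge> 0" "\<sigma> * orient a b c > 0 \<or> \<sigma> * orient a b d > 0"
  shows "open_segment a b \<inter> open_segment c d = {}"
proof -
  have "p \<notin> open_segment c d" if p: "p \<in> open_segment a b" for p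
  proof
    assume "p \<in> open_segment c d"
    then obtain s where s: "0 < s" "s < 1" "p = (1 - s) *\<^sub>R c + s *\<^sub>R d"
      by (auto simp: in_segment)
    have "0 = \<sigma> * orient a b p" using orient_on_segment[OF p] by simp
    also have "\<dots> = (1 - s) * (\<sigma> * orient a b c) + s * (\<sigma> * orient a b d)"
      unfolding s(3) orient_convex by (simp add: algebra_simps)
    also have "\<dots> > 0"
      using assms s by (smt (verit) mult_nonneg_nonneg mult_pos_pos)
    finally show False by simp
  qed
  thus ?thesis by auto
qed

text \<open>The combinatorial form of \<open>noncrossing\<close>. It mentions neither the positions nor the number of
nodes, so it passes to subsets of the edges and to sets of consecutive nodes.\<close>

definition crossing_free :: "nat set set \<Rightarrow> bool" where
  "crossing_free E \<longleftrightarrow> (\<forall>a b c d. a < b \<longrightarrow> b < c \<longrightarrow> c < d \<longrightarrow> {a, c} \<in> E \<longrightarrow> {b, d} \<notin> E)"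

lemma orient_node_sign:
  assumes "a < b" "b \<le> n" "c \<le> n"
  shows "a < c \<Longrightarrow> c < b \<Longrightarrow> orient (node_pos n a) (node_pos n b) (node_pos n c) < 0"
    and "c < a \<or> b < c \<Longrightarrow> orient (node_pos n a) (node_pos n b) (node_pos n c) > 0"
    and "c = a \<or> c = b \<Longrightarrow> orient (node_pos n a) (node_pos n b) (node_pos n c) = 0"
proof -
  show "orient (node_pos n a) (node_pos n b) (node_pos n c) < 0" if "a < c" "c < b"
    using orient_node_pos[of a c b n] that assms orient_swap[of "node_pos n a" "node_pos n b" "node_pos n c"] by simp
  show "orient (node_pos n a) (node_pos n b) (node_pos n c) > 0" if "c < a \<or> b < c"
    using orient_node_pos[of c a b n] orient_node_pos[of a b c n] that assms 
      orient_rotate[of "node_pos n a" "node_pos n b" "node_pos n c"] by auto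
  show "orient (node_pos n a) (node_pos n b) (node_pos n c) = 0" if "c = a \<or> c = b"
    using that by (auto simp: orient_def)
qed

lemma chords_disjoint:
  assumes ab: "a < b" "b \<le> n" and cd: "c < d" "d \<le> n" and ne: "(a, b) \<noteq> (c, d)"
    and nc: "\<not> (a < c \<and> c < b \<and> b < d)" "\<not> (c < a \<and> a < d \<and> d < b)"
  shows "open_segment (node_pos n a) (node_pos n b) \<inter> open_segment (node_pos n c) (node_pos n d) = {}"
proof -
  note sgn = orient_node_sign[OF ab]
  consider "a \<le> c" "d \<le> b" | "c \<le> a" "b \<le> d" | "d \<le> a" | "b \<le> c"
    using assms by linarith
  thus ?thesis
  proof cases
    case 1
    thus ?thesis
      using sgn[of c] sgn[of d] cd ne ab
      by (intro segments_disjoint_if_same_side[of "-1"]) (auto simp: le_less)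
  next
    case 2
    thus ?thesis
      using sgn[of c] sgn[of d] cd ne ab
      by (intro segments_disjoint_if_same_side[of "1"]) (auto simp: le_less)
  next
    case 3
    thus ?thesis
      using sgn[of c] sgn[of d] cd ne ab
      by (intro segments_disjoint_if_same_side[of "1"]) (auto simp: le_less)
  next
    case 4
    thus ?thesis
      using sgn[of c] sgn[of d] cd ne ab
      by (intro segments_disjoint_if_same_side[of "1"]) (auto simp: le_less)
  qed
qed

lemma noncrossing_iff_crossing_free:
  assumes E: "\<And>e. e \<in> E \<Longrightarrow> \<exists>a\<in>{0..n}. \<exists>b\<in>{0..n}. a \<noteq> b \<and> e = {a, b}"
  shows "noncrossing n E \<longleftrightarrow> crossing_free E"
proof
  assume nc: "noncrossing n E"
  show "crossing_free E"
    unfolding crossing_free_def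
  proof (intro allI impI notI)
    fix a b c d assume *: "a < b" "b < c" "c < d" "{a, c} \<in> E" "{b, d} \<in> E"
    have "d \<le> n" using E[OF *(5)] by (auto simp: doubleton_eq_iff)
    have "open_segment (node_pos n a) (node_pos n c) \<inter> open_segment (node_pos n b) (node_pos n d) \<noteq> {}"
      using * \<open>d \<le> n\<close> by (intro crossing_segments_meet orient_node_pos) auto
    thus False using nc * unfolding noncrossing_def
      by (metis doubleton_eq_iff less_irrefl order.strict_trans)
  qed
next
  assume cf: "crossing_free E"
  have edge: "a \<noteq> b \<and> a \<le> n \<and> b \<le> n" if "{a, b} \<in> E" for a b
    using E[OF that] by (auto simp: doubleton_eq_iff)
  have main: "open_segment (node_pos n a) (node_pos n b) \<inter> open_segment (node_pos n c) (node_pos n d) = {}"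
    if "{a, b} \<in> E" "{c, d} \<in> E" "{a, b} \<noteq> {c, d}" "a < b" "c < d" for a b c d
    using that edge[of a b] edge[of c d] cf unfolding crossing_free_def
    by (intro chords_disjoint) (auto simp: doubleton_eq_iff)
  show "noncrossing n E"
    unfolding noncrossing_def
  proof (intro allI impI)
    fix a b c d assume *: "{a, b} \<in> E \<and> {c, d} \<in> E \<and> {a, b} \<noteq> {c, d}"
    show "open_segment (node_pos n a) (node_pos n b) \<inter> open_segment (node_pos n c) (node_pos n d) = {}"
      using main[of "min a b" "max a b" "min c d" "max c d"] edge[of a b] edge[of c d] *
      by (cases a b rule: linorder_cases; cases c d rule: linorder_cases)
        (auto simp: min_def max_def insert_commute open_segment_commute)
  qed
qed

section \<open>Trees as connected graphs in which every edge is a bridge\<close>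

text \<open>Cycles are inconvenient when edge sets are cut and glued. Acyclicity is therefore replaced by the
condition that the ends of an edge are disconnected by its removal, so that only reachability
has to be followed. It can be transported along any map of the nodes that sends each edge to a
connected pair, in particular along a retraction onto a part of the tree (\<open>conn_map\<close>).\<close>

abbreviation conn :: "'a set set \<Rightarrow> 'a \<Rightarrow> 'a \<Rightarrow> bool" where
  "conn E \<equiv> (\<lambda>u v. {u, v} \<in> E)\<^sup>*\<^sup>*"

lemma conn_edge: "{u, v} \<in> E \<Longrightarrow> conn E u v"
  by (rule r_into_rtranclp)

lemma conn_sym: "conn E u v \<Longrightarrow> conn E v u"
proof (induction rule: rtranclp_induct)
  case (step v w)
  have "{w, v} \<in> E" using step.hyps(2) by (simp add: insert_commute)
  thus ?case using step.IH by (rule converse_rtranclp_into_rtranclp)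
qed simp

lemma conn_mono: "E \<subseteq> E' \<Longrightarrow> conn E u v \<Longrightarrow> conn E' u v"
  using rtranclp_mono[of "\<lambda>u v. {u, v} \<in> E" "\<lambda>u v. {u, v} \<in> E'"] by auto

lemma conn_map:
  assumes "conn E u v" and "\<And>u v. {u, v} \<in> E \<Longrightarrow> conn E' (f u) (f v)"
  shows "conn E' (f u) (f v)"
  using assms(1)
proof induction
  case (step v w)
  show ?case using step.IH assms(2)[OF step.hyps(2)] by (rule rtranclp_trans)
qed simp

definition edges_in :: "'a set \<Rightarrow> 'a set set \<Rightarrow> bool" where
  "edges_in V E \<longleftrightarrow> (\<forall>e\<in>E. \<exists>a\<in>V. \<exists>b\<in>V. a \<noteq> b \<and> e = {a, b})"

lemma edges_inD: "edges_in V E \<Longrightarrow> {u, v} \<in> E \<Longrightarrow> u \<in> V \<and> v \<in> V \<and> u \<noteq> v"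
  by (fastforce simp: edges_in_def doubleton_eq_iff)

lemma edges_in_subset: "edges_in V E \<Longrightarrow> e \<in> E \<Longrightarrow> e \<subseteq> V"
  by (fastforce simp: edges_in_def)

definition all_bridges :: "'a set set \<Rightarrow> bool" where
  "all_bridges E \<longleftrightarrow> (\<forall>a b. {a, b} \<in> E \<longrightarrow> \<not> conn (E - {{a, b}}) a b)"

lemma all_bridgesD: "all_bridges E \<Longrightarrow> {a, b} \<in> E \<Longrightarrow> \<not> conn (E - {{a, b}}) a b"
  by (simp add: all_bridges_def)

lemma all_bridges_subset:
  assumes "all_bridges E" "E' \<subseteq> E"
  shows "all_bridges E'"
  unfolding all_bridges_def
proof (intro allI impI notI)
  fix a b assume "{a, b} \<in> E'" "conn (E' - {{a, b}}) a b"
  moreover have "conn (E - {{a, b}}) a b"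
    using assms(2) by (intro conn_mono[OF _ \<open>conn (E' - {{a, b}}) a b\<close>]) auto
  ultimately show False using assms by (auto dest: all_bridgesD)
qed

lemma rtrancl_path_iff_successively:
  "rtrancl_path r u xs v \<longleftrightarrow> successively r (u # xs) \<and> last (u # xs) = v"
proof (induction xs arbitrary: u)
  case Nil
  show ?case by (subst rtrancl_path.simps) auto
next
  case (Cons x xs)
  have "rtrancl_path r u (x # xs) v \<longleftrightarrow> r u x \<and> rtrancl_path r x xs v"
    by (subst rtrancl_path.simps) auto
  thus ?case using Cons by auto
qed

lemma conn_imp_distinct_list:
  assumes "conn E u v"
  obtains xs where "successively (\<lambda>a b. {a, b} \<in> E) (u # xs)" "last (u # xs) = v" "distinct (u # xs)"
proof -
  obtain ys where "rtrancl_path (\<lambda>a b. {a, b} \<in> E) u ys v"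
    using assms by (auto simp: rtranclp_eq_rtrancl_path)
  then obtain xs where "rtrancl_path (\<lambda>a b. {a, b} \<in> E) u xs v" "distinct (u # xs)"
    by (rule rtrancl_path_distinct)
  thus ?thesis using that by (auto simp: rtrancl_path_iff_successively)
qed

lemma successively_imp_conn:
  assumes "successively (\<lambda>a b. {a, b} \<in> E) p" "p \<noteq> []"
  shows "conn E (hd p) (last p)"
proof -
  obtain u xs where p: "p = u # xs" using assms by (cases p) auto
  show ?thesis
    using assms rtrancl_path_iff_successively[of "\<lambda>a b. {a, b} \<in> E" u xs "last p"]
    unfolding p rtranclp_eq_rtrancl_path by auto
qed

lemma successively_edges_subset:
  assumes "edges_in V E" "successively (\<lambda>a b. {a, b} \<in> E) (u # xs)" "u \<in> V"
  shows "set (u # xs) \<subseteq> V"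
  using assms(2,3)
proof (induction xs arbitrary: u)
  case (Cons x xs)
  have "x \<in> V" using Cons.prems edges_inD[OF assms(1), of u x] by auto
  thus ?case using Cons by auto
qed auto

lemma acyclic_iff_all_bridges:
  assumes "edges_in V E"
  shows "(\<nexists>c. is_cycle E c) \<longleftrightarrow> all_bridges E"
proof
  assume nc: "\<nexists>c. is_cycle E c"
  show "all_bridges E"
    unfolding all_bridges_def
  proof (intro allI impI notI)
    fix a b assume ab: "{a, b} \<in> E" and "conn (E - {{a, b}}) a b"
    then obtain xs where xs: "successively (\<lambda>u v. {u, v} \<in> E - {{a, b}}) (a # xs)"
        "last (a # xs) = b" "distinct (a # xs)"
      by (elim conn_imp_distinct_list)
    have "a \<noteq> b" using edges_inD[OF assms ab] by simp
    then obtain x y ys where xs_eq: "xs = x # y # ys"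
      using xs by (cases xs rule: remdups_adj.cases) auto
    have "is_cycle E (a # xs)"
      unfolding is_cycle_def
    proof (intro conjI)
      show "successively (\<lambda>u v. {u, v} \<in> E) (a # xs)"
        using xs(1) by (rule successively_mono) auto
      show "{last (a # xs), hd (a # xs)} \<in> E" 
        unfolding xs(2) using ab by (simp add: insert_commute)
    qed (use xs xs_eq in auto)
    thus False using nc by blast
  qed
next
  assume br: "all_bridges E"
  show "\<nexists>c. is_cycle E c"
  proof
    assume "\<exists>c. is_cycle E c"
    then obtain c where c: "length c \<ge> 3" "distinct c" "successively (\<lambda>a b. {a, b} \<in> E) c"
        "{last c, hd c} \<in> E"
      by (auto simp: is_cycle_def)
    have ne: "c \<noteq> []" using c(1) by auto
    have "{c ! i, c ! Suc i} \<noteq> {hd c, last c}" if "Suc i < length c" for i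
      using that c(1,2) ne
      by (auto simp: doubleton_eq_iff hd_conv_nth last_conv_nth nth_eq_iff_index_eq)
    hence "successively (\<lambda>a b. {a, b} \<in> E - {{hd c, last c}}) c"
      using c(3) by (auto simp: successively_conv_nth)
    hence "conn (E - {{hd c, last c}}) (hd c) (last c)"
      using ne by (rule successively_imp_conn)
    moreover have "{hd c, last c} \<in> E" using c(4) by (simp add: insert_commute)
    ultimately show False using br by (auto dest: all_bridgesD)
  qed
qed

definition tree_on :: "'a set \<Rightarrow> 'a set set \<Rightarrow> bool" where
  "tree_on V E \<longleftrightarrow> V \<noteq> {} \<and> edges_in V E \<and> (\<forall>u\<in>V. \<forall>v\<in>V. conn E u v) \<and> all_bridges E"

lemma ex_path_iff_conn:
  assumes "edges_in V E" "u \<in> V"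
  shows "(\<exists>p. is_path V E u v p) \<longleftrightarrow> conn E u v"
proof
  assume "\<exists>p. is_path V E u v p"
  thus "conn E u v" by (auto simp: is_path_def dest: successively_imp_conn)
next
  assume "conn E u v"
  then obtain xs where xs: "successively (\<lambda>a b. {a, b} \<in> E) (u # xs)" "last (u # xs) = v" 
      "distinct (u # xs)"
    by (rule conn_imp_distinct_list)
  have "is_path V E u v (u # xs)"
    unfolding is_path_def using xs successively_edges_subset[OF assms(1) xs(1) assms(2)] by auto
  thus "\<exists>p. is_path V E u v p" ..
qed

lemma is_tree_iff_tree_on: "is_tree V E \<longleftrightarrow> tree_on V E"
proof (cases "edges_in V E")
  case True
  show ?thesis
    using True acyclic_iff_all_bridges[OF True] ex_path_iff_conn[OF True]
    unfolding is_tree_def tree_on_def by (auto simp: edges_in_def)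
next
  case False
  thus ?thesis unfolding is_tree_def tree_on_def edges_in_def by blast
qed

lemma tree_onI:
  assumes "edges_in V E" "r \<in> V" "\<And>v. v \<in> V \<Longrightarrow> conn E r v" "all_bridges E"
  shows "tree_on V E"
proof -
  have "conn E u v" if "u \<in> V" "v \<in> V" for u v
    using conn_sym[OF assms(3)[OF that(1)]] assms(3)[OF that(2)] by (rule rtranclp_trans)
  thus ?thesis using assms by (auto simp: tree_on_def)
qed

text \<open>Two different paths with the same ends would, at the first place where they part, provide a detour
around an edge.\<close>

lemma distinct_walk_unique:
  assumes "all_bridges E"
    and "successively (\<lambda>a b. {a, b} \<in> E) p" "distinct p" "p \<noteq> []"
    and "successively (\<lambda>a b. {a, b} \<in> E) q" "distinct q" "q \<noteq> []"
    and "hd p = hd q" "last p = last q"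
  shows "p = q"
  using assms(2-)
proof (induction p arbitrary: q)
  case (Cons u p)
  obtain q' where q: "q = u # q'" using Cons.prems by (cases q) auto
  show ?case
  proof (cases "p = [] \<or> q' = []")
    case True
    thus ?thesis
    proof
      assume "p = []"
      hence "last q = u" using Cons.prems by simp
      thus ?thesis using \<open>p = []\<close> Cons.prems last_in_set[of q'] by (cases "q' = []") (auto simp: q)
    next
      assume "q' = []"
      hence "last (u # p) = u" using Cons.prems by (simp add: q)
      thus ?thesis using \<open>q' = []\<close> Cons.prems last_in_set[of p] by (cases "p = []") (auto simp: q)
    qed
  next
    case False
    then obtain x y p1 q1 where p: "p = x # p1" and q': "q' = y # q1"
      by (cases p; cases q') auto
    show ?thesis
    proof (cases "x = y")
      case True
      have "p = q'" using Cons.prems True by (intro Cons.IH) (auto simp: p q q')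
      thus ?thesis by (simp add: q)
    next
      case False
      have edge: "{u, x} \<in> E" using Cons.prems by (simp add: p)
      \<comment> \<open>Neither tail visits \<open>u\<close>, so both avoid the edge from \<open>u\<close> to \<open>x\<close>.\<close>
      have *: "successively (\<lambda>a b. {a, b} \<in> E - {{u, x}}) l"
        if "successively (\<lambda>a b. {a, b} \<in> E) l" "u \<notin> set l" for l
        using that(1) by (rule successively_mono) (use that(2) in \<open>auto simp: doubleton_eq_iff\<close>)
      have "conn (E - {{u, x}}) x (last p)"
        using *[of p] Cons.prems successively_imp_conn[of "E - {{u, x}}" p] by (simp add: p)
      moreover have "successively (\<lambda>a b. {a, b} \<in> E - {{u, x}}) q"
        using *[of q'] Cons.prems False by (auto simp: q q' doubleton_eq_iff)
      hence "conn (E - {{u, x}}) u (last q)"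
        using successively_imp_conn[of "E - {{u, x}}" q] by (simp add: q)
      moreover have "last p = last q" using Cons.prems p by simp
      ultimately have "conn (E - {{u, x}}) u x"
        using rtranclp_trans[OF _ conn_sym, of "E - {{u, x}}" u "last p" x] by simp
      thus ?thesis using all_bridgesD[OF assms(1) edge] by blast
    qed
  qed
qed auto

lemma tree_on_image:
  assumes T: "tree_on V E" and inj: "inj_on f V"
  shows "tree_on (f ` V) ((`) f ` E)"
proof -
  define E' where "E' = (`) f ` E"
  have E: "edges_in V E" and br: "all_bridges E" using T by (auto simp: tree_on_def)
  have E'I: "{f u, f v} \<in> E'" if "{u, v} \<in> E" for u v
    using that unfolding E'_def by (intro image_eqI[of _ _ "{u, v}"]) auto
  have E'D: "\<exists>u v. {u, v} \<in> E \<and> u \<in> V \<and> v \<in> V \<and> u' = f u \<and> v' = f v" if uv: "{u', v'} \<in> E'" for u' v'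
  proof -
    obtain e where e: "e \<in> E" "{u', v'} = f ` e" using uv by (auto simp: E'_def)
    obtain u v where uv: "e = {u, v}" using E e by (auto simp: edges_in_def)
    have "{u, v} \<in> E" "{v, u} \<in> E" using e(1) by (auto simp: uv insert_commute)
    moreover have "u' = f u \<and> v' = f v \<or> u' = f v \<and> v' = f u"
      using e(2) by (auto simp: uv doubleton_eq_iff)
    ultimately show ?thesis using edges_inD[OF E, of u v] by blast
  qed
  have "edges_in (f ` V) E'"
    unfolding edges_in_def
  proof
    fix e assume "e \<in> E'"
    then obtain e0 where e0: "e0 \<in> E" "e = f ` e0" by (auto simp: E'_def)
    then obtain a b where ab: "a \<in> V" "b \<in> V" "a \<noteq> b" "e0 = {a, b}" 
      using E by (auto simp: edges_in_def)
    thus "\<exists>a\<in>f ` V. \<exists>b\<in>f ` V. a \<noteq> b \<and> e = {a, b}"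
      using inj by (intro bexI[of _ "f a"] bexI[of _ "f b"]) (auto simp: e0 inj_on_eq_iff)
  qed
  moreover have "conn E' (f u) (f v)" if "u \<in> V" "v \<in> V" for u v
    by (rule conn_map[of E]) (use T that E'I in \<open>auto simp: tree_on_def intro: conn_edge\<close>)
  moreover have "all_bridges E'"
    unfolding all_bridges_def
  proof (intro allI impI notI)
    fix a' b' assume "{a', b'} \<in> E'" and conn: "conn (E' - {{a', b'}}) a' b'"
    then obtain a b where ab: "{a, b} \<in> E" "a \<in> V" "b \<in> V" "a' = f a" "b' = f b"
      using E'D by blast
    have "conn (E - {{a, b}}) (inv_into V f a') (inv_into V f b')"
      using conn
    proof (rule conn_map)
      fix u' v' assume uv': "{u', v'} \<in> E' - {{a', b'}}"
      then obtain u v where uv: "{u, v} \<in> E" "u \<in> V" "v \<in> V" "u' = f u" "v' = f v"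
        using E'D by blast
      have "{u, v} \<noteq> {a, b}" using uv' uv ab by (auto simp: doubleton_eq_iff)
      thus "conn (E - {{a, b}}) (inv_into V f u') (inv_into V f v')"
        using uv inj by (auto intro: conn_edge)
    qed
    thus False using all_bridgesD[OF br ab(1)] ab inj by simp
  qed
  moreover have "V \<noteq> {}" using T by (simp add: tree_on_def)
  ultimately show ?thesis unfolding tree_on_def E'_def[symmetric] by auto
qed

section \<open>Splitting a noncrossing tree at the largest neighbour of the root\<close>

definition nc_trees_on :: "nat \<Rightarrow> nat \<Rightarrow> nat set set set" where
  "nc_trees_on a b = {E. tree_on {a..b} E \<and> crossing_free E}"

lemma noncrossing_trees_eq: "noncrossing_trees n = nc_trees_on 0 n"
  unfolding noncrossing_trees_def nc_trees_on_def is_tree_iff_tree_on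
  using noncrossing_iff_crossing_free[of _ n] by (auto simp: tree_on_def edges_in_def)

lemma crossing_free_subset: "crossing_free E \<Longrightarrow> E' \<subseteq> E \<Longrightarrow> crossing_free E'"
  unfolding crossing_free_def by (meson subsetD)

lemma crossing_freeD: 
  "crossing_free E \<Longrightarrow> {a, c} \<in> E \<Longrightarrow> {b, d} \<in> E \<Longrightarrow> a < b \<Longrightarrow> b < c \<Longrightarrow> c < d \<Longrightarrow> False"
  unfolding crossing_free_def by blast

text \<open>A tree on an interval is moved to the standard node set by a shift, or by a reflection when its
root is its last node.\<close>

lemma nc_trees_on_image:
  assumes E: "E \<in> nc_trees_on a b"
    and mono: "strict_mono_on {a..b} f \<or> strict_antimono_on {a..b} f"
    and img: "f ` {a..b} = {a'..b'}"
  shows "(`) f ` E \<in> nc_trees_on a' b'"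
proof -
  have T: "tree_on {a..b} E" and cf: "crossing_free E" using E by (auto simp: nc_trees_on_def)
  have EI: "edges_in {a..b} E" using T by (simp add: tree_on_def)
  have inj: "inj_on f {a..b}"
    using mono unfolding monotone_on_def inj_on_def
    by (metis less_irrefl linorder_neqE_nat)
  have lift: "\<exists>u v. {u, v} \<in> E \<and> u \<in> {a..b} \<and> v \<in> {a..b} \<and> u' = f u \<and> v' = f v" 
    if uv: "{u', v'} \<in> (`) f ` E" for u' v'
  proof -
    obtain e where e: "e \<in> E" "{u', v'} = f ` e" using uv by auto
    obtain u v where uv: "e = {u, v}" using EI e by (auto simp: edges_in_def)
    have "{u, v} \<in> E" "{v, u} \<in> E" using e(1) by (auto simp: uv insert_commute)
    moreover have "u' = f u \<and> v' = f v \<or> u' = f v \<and> v' = f u"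
      using e(2) by (auto simp: uv doubleton_eq_iff)
    ultimately show ?thesis using edges_inD[OF EI, of u v] by blast
  qed
  have "crossing_free ((`) f ` E)"
    unfolding crossing_free_def
  proof (intro allI impI notI)
    fix w' x' y' z' :: nat
    assume lt: "w' < x'" "x' < y'" "y' < z'" and "{w', y'} \<in> (`) f ` E" "{x', z'} \<in> (`) f ` E"
    then obtain w y x z where wy: "{w, y} \<in> E" "w \<in> {a..b}" "y \<in> {a..b}" "w' = f w" "y' = f y"
      and xz: "{x, z} \<in> E" "x \<in> {a..b}" "z \<in> {a..b}" "x' = f x" "z' = f z"
      by (metis lift)
    from mono show False
    proof
      assume "strict_mono_on {a..b} f"
      hence "w < x" "x < y" "y < z"
        using lt wy xz strict_mono_on_less[of "{a..b}" f] by simp_all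
      thus False using crossing_freeD[OF cf wy(1) xz(1)] by blast
    next
      assume m: "strict_antimono_on {a..b} f"
      have "v < u" if "u \<in> {a..b}" "v \<in> {a..b}" "f u < f v" for u v
        using that m unfolding monotone_on_def 
        by (metis less_asym less_irrefl linorder_neqE_nat)
      hence "z < y" "y < x" "x < w" using lt wy xz by auto
      thus False using crossing_freeD[OF cf, of z x y w] wy(1) xz(1) by (simp add: insert_commute)
    qed
  qed
  thus ?thesis
    using tree_on_image[OF T inj] unfolding img nc_trees_on_def by simp
qed


lemma glued_edge_cases:
  assumes "edges_in {0..s} E1" "edges_in {Suc s..c} E2" "edges_in {c..n} E3"
    and "{u, v} \<in> E1 \<union> E0 \<union> E2 \<union> E3" "E0 \<subseteq> {{0, c}}"
  obtains (left) "{u, v} \<in> E1" "u \<le> s" "v \<le> s"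
    | (link) "{u, v} \<in> E0" "u = 0 \<and> v = c \<or> u = c \<and> v = 0"
    | (middle) "{u, v} \<in> E2" "s < u" "u \<le> c" "s < v" "v \<le> c"
    | (right) "{u, v} \<in> E3" "c \<le> u" "c \<le> v"
proof -
  have "{u, v} \<in> E0 \<Longrightarrow> u = 0 \<and> v = c \<or> u = c \<and> v = 0"
    using assms(5) by (auto simp: doubleton_eq_iff)
  thus ?thesis
    using assms(4) that edges_inD[OF assms(1), of u v] edges_inD[OF assms(2), of u v]
      edges_inD[OF assms(3), of u v] unfolding Un_iff atLeastAtMost_iff Suc_le_eq by blast
qed

text \<open>The retractions collapse the other parts to the node where they are attached to the given one, so
any walk in the glued graph projects to a walk inside the part. The set \<open>E0\<close> of link edges is
empty or a singleton, because both the whole tree and the tree without its link are needed.\<close>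

lemma conn_retract:
  assumes E: "edges_in {0..s} E1" "edges_in {Suc s..c} E2" "edges_in {c..n} E3" "E0 \<subseteq> {{0, c}}"
    and "s < c" and conn: "conn (E1 \<union> E0 \<union> E2 \<union> E3) u v"
  shows "conn E1 (if u \<le> s then u else 0) (if v \<le> s then v else 0)"
    and "conn E2 (if u \<le> s then c else min u c) (if v \<le> s then c else min v c)"
    and "conn E3 (max u c) (max v c)"
    and "E0 = {} \<Longrightarrow> u \<le> s \<longleftrightarrow> v \<le> s"
proof -
  note cases = glued_edge_cases[OF E(1,2,3) _ E(4)]
  show "conn E1 (if u \<le> s then u else 0) (if v \<le> s then v else 0)"
    using conn
  proof (rule conn_map)
    fix u v assume "{u, v} \<in> E1 \<union> E0 \<union> E2 \<union> E3"
    thus "conn E1 (if u \<le> s then u else 0) (if v \<le> s then v else 0)"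
      by (cases rule: cases) (use \<open>s < c\<close> in \<open>auto intro: conn_edge\<close>)
  qed
  show "conn E2 (if u \<le> s then c else min u c) (if v \<le> s then c else min v c)"
    using conn
  proof (rule conn_map)
    fix u v assume "{u, v} \<in> E1 \<union> E0 \<union> E2 \<union> E3"
    thus "conn E2 (if u \<le> s then c else min u c) (if v \<le> s then c else min v c)"
      by (cases rule: cases) (use \<open>s < c\<close> in \<open>auto intro: conn_edge simp: min_def\<close>)
  qed
  show "conn E3 (max u c) (max v c)"
    using conn
  proof (rule conn_map)
    fix u v assume "{u, v} \<in> E1 \<union> E0 \<union> E2 \<union> E3"
    thus "conn E3 (max u c) (max v c)"
      by (cases rule: cases) (use \<open>s < c\<close> in \<open>auto intro: conn_edge simp: max_def\<close>)
  qed
  show "u \<le> s \<longleftrightarrow> v \<le> s" if "E0 = {}"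
    using conn
  proof (induction rule: rtranclp_induct)
    case (step v w)
    from step.hyps(2) have "v \<le> s \<longleftrightarrow> w \<le> s"
      by (cases rule: cases) (use \<open>s < c\<close> that in auto)
    thus ?case using step.IH by simp
  qed simp
qed

lemma edges_in_mono: "edges_in V E \<Longrightarrow> V \<subseteq> V' \<Longrightarrow> E' \<subseteq> E \<Longrightarrow> edges_in V' E'"
  unfolding edges_in_def by (meson subsetD)

text \<open>An edge of one part is a bridge of the whole graph because a detour around it would be retracted to
a detour inside that part.\<close>

lemma nc_trees_on_glue:
  assumes E1: "E1 \<in> nc_trees_on 0 s" and E2: "E2 \<in> nc_trees_on (Suc s) c" 
    and E3: "E3 \<in> nc_trees_on c n" and le: "s < c" "c \<le> n"
  shows "E1 \<union> {{0, c}} \<union> E2 \<union> E3 \<in> nc_trees_on 0 n"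
proof -
  let ?G = "E1 \<union> {{0, c}} \<union> E2 \<union> E3"
  have T: "tree_on {0..s} E1" "tree_on {Suc s..c} E2" "tree_on {c..n} E3"
    and cf: "crossing_free E1" "crossing_free E2" "crossing_free E3"
    using assms by (auto simp: nc_trees_on_def)
  hence ed: "edges_in {0..s} E1" "edges_in {Suc s..c} E2" "edges_in {c..n} E3"
    and br: "all_bridges E1" "all_bridges E2" "all_bridges E3"
    by (auto simp: tree_on_def)
  note cases = glued_edge_cases[OF ed _ subset_refl, consumes 1, case_names left link middle right]
  have "tree_on {0..n} ?G"
  proof (rule tree_onI)
    have "edges_in {0..n} E1" "edges_in {0..n} E2" "edges_in {0..n} E3"
      by (rule edges_in_mono[OF ed(1)] edges_in_mono[OF ed(2)] edges_in_mono[OF ed(3)];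
        use le in auto)+
    moreover have "edges_in {0..n} {{0, c}}"
    proof -
      have "\<exists>a\<in>{0..n}. \<exists>b\<in>{0..n}. a \<noteq> b \<and> {0, c} = {a, b}"
        by (rule bexI[of _ 0], rule bexI[of _ c]) (use le in auto)
      thus ?thesis by (simp add: edges_in_def)
    qed
    ultimately show "edges_in {0..n} ?G"
      unfolding edges_in_def ball_Un by blast
    show "0 \<in> {0..n}" by simp
    fix v assume v: "v \<in> {0..n}"
    have c: "conn ?G 0 c" by (rule conn_edge) simp
    consider "v \<le> s" | "s < v" "v \<le> c" | "c \<le> v" by linarith
    thus "conn ?G 0 v"
    proof cases
      case 1
      hence "conn E1 0 v" using T(1) by (auto simp: tree_on_def)
      thus ?thesis by (rule conn_mono[rotated]) auto
    next
      case 2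
      hence "conn E2 c v" using T(2) by (auto simp: tree_on_def)
      hence "conn ?G c v" by (rule conn_mono[rotated]) auto
      thus ?thesis using c by (rule rtranclp_trans[rotated])
    next
      case 3
      hence "conn E3 c v" using T(3) v by (auto simp: tree_on_def)
      hence "conn ?G c v" by (rule conn_mono[rotated]) auto
      thus ?thesis using c by (rule rtranclp_trans[rotated])
    qed
  next
    show "all_bridges ?G"
      unfolding all_bridges_def
    proof (intro allI impI notI)
      fix a b assume ab: "{a, b} \<in> ?G" and "conn (?G - {{a, b}}) a b"
      define D where "D = {{a, b}}"
      have *: "?G - D = (E1 - D) \<union> ({{0, c}} - D) \<union> (E2 - D) \<union> (E3 - D)" by auto
      have "conn ((E1 - D) \<union> ({{0, c}} - D) \<union> (E2 - D) \<union> (E3 - D)) a b"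
        using \<open>conn (?G - {{a, b}}) a b\<close> unfolding D_def[symmetric] * .
      note R = conn_retract[OF edges_in_mono[OF ed(1) subset_refl] edges_in_mono[OF ed(2) subset_refl]
          edges_in_mono[OF ed(3) subset_refl] _ le(1) this]
      from ab show False
      proof (cases rule: cases)
        case left
        thus False using R(1) all_bridgesD[OF br(1) left(1)] by (auto simp: D_def)
      next
        case link
        have "{{0, c}} - D = {}" using link by (auto simp: D_def)
        thus False using R(4) link le by auto
      next
        case middle
        thus False using R(2) all_bridgesD[OF br(2) middle(1)] by (auto simp: D_def)
      next
        case right
        thus False using R(3) all_bridgesD[OF br(3) right(1)] by (auto simp: D_def max_def)
      qed
    qed
  qed
  moreover have "crossing_free ?G"
    unfolding crossing_free_def
  proof (intro allI impI notI)
    fix w x y z assume lt: "w < x" "x < y" "y < z" and wy: "{w, y} \<in> ?G" and xz: "{x, z} \<in> ?G"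
    from wy show False
    proof (cases rule: cases)
      case left
      from xz show False
        by (cases rule: cases) (use left lt le crossing_freeD[OF cf(1) left(1)] in auto)
    next
      case link
      from xz show False
        by (cases rule: cases) (use link lt le in auto)
    next
      case middle
      from xz show False
        by (cases rule: cases) (use middle lt le crossing_freeD[OF cf(2) middle(1)] in auto)
    next
      case right
      from xz show False
        by (cases rule: cases) (use right lt le crossing_freeD[OF cf(3) right(1)] in auto)
    qed
  qed
  ultimately show ?thesis by (simp add: nc_trees_on_def)
qed


lemma edges_in_restrict: "edges_in V E \<Longrightarrow> edges_in W {e \<in> E. e \<subseteq> W}"
  by (fastforce simp: edges_in_def)

text \<open>The link is the edge from \<open>0\<close> to its largest neighbour \<open>c\<close>, and \<open>{0..s}\<close> is the component of \<open>0\<close> after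
its removal.\<close>

lemma nc_trees_on_decompose:
  assumes E: "E \<in> nc_trees_on 0 n" and n: "n > 0"
  obtains s c where "s < c" "c \<le> n"
    "E = {e \<in> E. e \<subseteq> {0..s}} \<union> {{0, c}} \<union> {e \<in> E. e \<subseteq> {Suc s..c}} \<union> {e \<in> E. e \<subseteq> {c..n}}"
    "{e \<in> E. e \<subseteq> {0..s}} \<in> nc_trees_on 0 s"
    "{e \<in> E. e \<subseteq> {Suc s..c}} \<in> nc_trees_on (Suc s) c"
    "{e \<in> E. e \<subseteq> {c..n}} \<in> nc_trees_on c n"
proof -
  have ed: "edges_in {0..n} E" and br: "all_bridges E" and cf: "crossing_free E"
    and conn: "\<And>v. v \<le> n \<Longrightarrow> conn E 0 v"
    using E by (auto simp: nc_trees_on_def tree_on_def)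
  note edD = edges_inD[OF ed]
  define N where "N = {v. {0, v} \<in> E}"
  have "finite N" by (rule finite_subset[of _ "{0..n}"]) (auto simp: N_def dest: edD)
  have "conn E 0 n" using conn by simp
  then obtain v where "{0, v} \<in> E" using n by (auto elim: converse_rtranclpE)
  hence "N \<noteq> {}" by (auto simp: N_def)
  define c where "c = Max N"
  have c: "{0, c} \<in> E" using Max_in[OF \<open>finite N\<close> \<open>N \<noteq> {}\<close>] by (simp add: c_def N_def)
  have c_max: "v \<le> c" if "{0, v} \<in> E" for v
    using that \<open>finite N\<close> by (simp add: c_def N_def)
  have c0: "0 < c" "c \<le> n" using edD[OF c] by auto
  define E' where "E' = E - {{0, c}}"
  have E'D: "{u, v} \<in> E" if "{u, v} \<in> E'" for u v using that by (simp add: E'_def)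
  have not0c: "\<not> conn E' 0 c" using all_bridgesD[OF br c] by (simp add: E'_def)
  have join: "conn E' 0 w" if "conn E' 0 v" "{v, w} \<in> E'" for v w
    using that by (rule rtranclp.rtrancl_into_rtrancl)
  have either: "conn E' 0 v \<or> conn E' c v" if "v \<le> n" for v
    using conn[OF that]
  proof (induction rule: rtranclp_induct)
    case (step v w)
    show ?case
    proof (cases "{v, w} = {0, c}")
      case True
      thus ?thesis by (auto simp: doubleton_eq_iff)
    next
      case False
      hence "{v, w} \<in> E'" using step.hyps by (simp add: E'_def)
      thus ?thesis using step.IH by (auto intro: rtranclp.rtrancl_into_rtrancl)
    qed
  qed simp
  \<comment> \<open>A walk from \<open>0\<close> cannot get past \<open>c\<close>: an edge from \<open>0\<close> would contradict the choice of \<open>c\<close>, and an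
      edge from a node between \<open>0\<close> and \<open>c\<close> would cross the link.\<close>
  have below_c: "v < c" if "conn E' 0 v" for v
    using that
  proof (induction rule: rtranclp_induct)
    case (step v w)
    have "w \<noteq> c" using join[OF step.hyps(1,2)] not0c by auto
    moreover have "\<not> c < w"
    proof
      assume "c < w"
      show False
      proof (cases "v = 0")
        case True
        thus False using c_max[of w] E'D[OF step.hyps(2)] \<open>c < w\<close> by simp
      next
        case False
        thus False using crossing_freeD[OF cf c E'D[OF step.hyps(2)]] step.IH \<open>c < w\<close> by simp
      qed
    qed
    ultimately show ?case by simp
  qed (use c0 in simp)
  \<comment> \<open>The component of \<open>0\<close> is an initial segment: if it skipped \<open>u\<close>, then one of its edges would pass over
      \<open>u\<close>, and the walk from \<open>c\<close> to \<open>u\<close> would have to cross this edge.\<close>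
  have down: "conn E' 0 u" if v: "conn E' 0 v" and "u < v" for u v
  proof (rule ccontr)
    assume u: "\<not> conn E' 0 u"
    hence "u \<noteq> 0" by (auto intro: gr0I)
    have "conn E' c u" using either[of u] u below_c[OF v] \<open>u < v\<close> c0 by auto
    have "v < u \<or> (\<exists>p q. {p, q} \<in> E' \<and> conn E' 0 p \<and> conn E' 0 q \<and> p < u \<and> u < q)"
      using v
    proof (induction rule: rtranclp_induct)
      case (step v w)
      have "conn E' 0 w" using join[OF step.hyps] .
      moreover from this have "w \<noteq> u" using u by auto
      ultimately consider "w < u" | "u < w" "conn E' 0 w" by linarith
      thus ?case
      proof cases
        case 2
        thus ?thesis using step.IH step.hyps by blast
      qed simp
    qed (use \<open>u \<noteq> 0\<close> in simp)
    then obtain p q where pq: "{p, q} \<in> E'" "conn E' 0 p" "conn E' 0 q" "p < u" "u < q"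
      using \<open>u < v\<close> by auto
    have "w < p \<or> q < w" if "conn E' c w" for w
      using that
    proof (induction rule: rtranclp_induct)
      case base
      show ?case using below_c[OF pq(3)] by simp
    next
      case (step w x)
      have cx: "conn E' c x" using step.hyps by (rule rtranclp.rtrancl_into_rtrancl)
      have "\<not> conn E' 0 x" using not0c conn_sym[OF cx] rtranclp_trans[of _ 0 x c] by blast
      hence "x \<noteq> p" "x \<noteq> q" using pq by auto
      moreover have "\<not> (p < x \<and> x < q)"
      proof
        assume x: "p < x \<and> x < q"
        from step.IH show False
        proof
          assume "w < p"
          thus False using x crossing_freeD[OF cf E'D[OF step.hyps(2)] E'D[OF pq(1)]] by auto
        next
          assume "q < w"
          moreover have "{x, w} \<in> E" using E'D[OF step.hyps(2)] by (simp add: insert_commute)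
          ultimately show False using x crossing_freeD[OF cf E'D[OF pq(1)], of x w] by auto
        qed
      qed
      ultimately show ?case by auto
    qed
    thus False using \<open>conn E' c u\<close> pq by fastforce
  qed
  define A where "A = {v. conn E' 0 v}"
  define s where "s = Max A"
  have finA: "finite A" by (rule finite_subset[of _ "{..<c}"]) (auto simp: A_def below_c)
  have "0 \<in> A" by (simp add: A_def)
  hence "s \<in> A" using Max_in[OF finA] by (auto simp: s_def)
  have A: "conn E' 0 v \<longleftrightarrow> v \<le> s" for v
    using Max_ge[OF finA, of v] \<open>s \<in> A\<close> down[of s v] unfolding s_def[symmetric] 
    by (cases "v = s") (auto simp: A_def)
  have "s < c" using A[of s] below_c by simp
  have C: "conn E' c v" if "s < v" "v \<le> n" for v
    using either[of v] A[of v] that by simp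
  define E1 E2 E3 where "E1 = {e \<in> E. e \<subseteq> {0..s}}" and "E2 = {e \<in> E. e \<subseteq> {Suc s..c}}" 
    and "E3 = {e \<in> E. e \<subseteq> {c..n}}"
  have sub: "E1 \<subseteq> E" "E2 \<subseteq> E" "E3 \<subseteq> E" by (auto simp: E1_def E2_def E3_def)
  have classify: "e \<in> E1 \<union> E2 \<union> E3" if e: "e \<in> E'" for e
  proof -
    obtain u v where uv: "e = {u, v}" "u < v" "v \<le> n" 
    proof -
      obtain a b where "a \<noteq> b" "e = {a, b}" "a \<le> n" "b \<le> n"
        using ed e by (fastforce simp: E'_def edges_in_def)
      thus ?thesis using that[of a b] that[of b a] 
        by (cases a b rule: linorder_cases) (auto simp: insert_commute)
    qed
    have e': "{u, v} \<in> E'" "{v, u} \<in> E'" using e uv by (auto simp: insert_commute)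
    have "u \<le> s \<longleftrightarrow> v \<le> s" using join[OF _ e'(1)] join[OF _ e'(2)] by (auto simp: A[symmetric])
    moreover have "\<not> (u < c \<and> c < v)" if "s < u"
      using crossing_freeD[OF cf c E'D[OF e'(1)]] that by auto
    ultimately show ?thesis
      using e' uv E'D[OF e'(1)] by (auto simp: E1_def E2_def E3_def)
  qed
  have ed': "edges_in {0..s} E1" "edges_in {Suc s..c} E2" "edges_in {c..n} E3"
    unfolding E1_def E2_def E3_def by (rule edges_in_restrict[OF ed])+
  have "E' \<subseteq> E1 \<union> {} \<union> E2 \<union> E3" using classify by auto
  note E'_conn = conn_mono[OF this]
  note R = conn_retract[OF ed' empty_subsetI \<open>s < c\<close> E'_conn]
  have "tree_on {0..s} E1"
  proof (rule tree_onI[OF ed'(1), of 0])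
    show "conn E1 0 v" if "v \<in> {0..s}" for v
      using R(1)[of 0 v] A[of v] that by simp
  qed (use all_bridges_subset[OF br sub(1)] in simp_all)
  moreover have "tree_on {Suc s..c} E2"
  proof (rule tree_onI[OF ed'(2), of c])
    show "conn E2 c v" if "v \<in> {Suc s..c}" for v
      using R(2)[of c v] C[of v] that c0 \<open>s < c\<close> by (simp add: min_absorb1)
  qed (use all_bridges_subset[OF br sub(2)] \<open>s < c\<close> in simp_all)
  moreover have "tree_on {c..n} E3"
  proof (rule tree_onI[OF ed'(3), of c])
    show "conn E3 c v" if "v \<in> {c..n}" for v
      using R(3)[of c v] C[of v] that \<open>s < c\<close> by (simp add: max_absorb1)
  qed (use all_bridges_subset[OF br sub(3)] c0 in simp_all)
  moreover have "E = E1 \<union> {{0, c}} \<union> E2 \<union> E3"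
    using classify sub c by (auto simp: E'_def)
  ultimately show ?thesis
    using that[OF \<open>s < c\<close> c0(2)] crossing_free_subset[OF cf sub(1)] crossing_free_subset[OF cf sub(2)]
      crossing_free_subset[OF cf sub(3)]
    unfolding nc_trees_on_def E1_def[symmetric] E2_def[symmetric] E3_def[symmetric] by blast
qed

text \<open>The parts meet in at most one node, hence share no edge and can be read off from the glued graph.\<close>

lemma glue_restrict:
  assumes "edges_in {0..s} E1" "edges_in {Suc s..c} E2" "edges_in {c..n} E3" "s < c"
    and G: "G = E1 \<union> {{0, c}} \<union> E2 \<union> E3"
  shows "E1 = {e \<in> G. e \<subseteq> {0..s}}" "E2 = {e \<in> G. e \<subseteq> {Suc s..c}}" "E3 = {e \<in> G. e \<subseteq> {c..n}}"
proof -
  have 1: "\<exists>a b. a \<noteq> b \<and> a \<le> s \<and> b \<le> s \<and> e = {a, b}" if "e \<in> E1" for e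
    using assms(1) that by (fastforce simp: edges_in_def)
  have 2: "\<exists>a b. a \<noteq> b \<and> s < a \<and> s < b \<and> a \<le> c \<and> b \<le> c \<and> e = {a, b}" if "e \<in> E2" for e
    using assms(2) that by (fastforce simp: edges_in_def)
  have 3: "\<exists>a b. a \<noteq> b \<and> c \<le> a \<and> c \<le> b \<and> a \<le> n \<and> b \<le> n \<and> e = {a, b}" if "e \<in> E3" for e
    using assms(3) that by (fastforce simp: edges_in_def)
  have "e \<subseteq> {0..s}" "\<not> e \<subseteq> {Suc s..c}" "\<not> e \<subseteq> {c..n}" if "e \<in> E1" for e
    using 1[OF that] \<open>s < c\<close> by auto
  moreover have "\<not> e \<subseteq> {0..s}" "e \<subseteq> {Suc s..c}" "\<not> e \<subseteq> {c..n}" if "e \<in> E2" for e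
    using 2[OF that] by auto
  moreover have "\<not> e \<subseteq> {0..s}" "\<not> e \<subseteq> {Suc s..c}" "e \<subseteq> {c..n}" if "e \<in> E3" for e
    using 3[OF that] \<open>s < c\<close> by auto
  moreover have "\<not> {0, c} \<subseteq> {0..s}" "\<not> {0, c} \<subseteq> {Suc s..c}" "\<not> {0, c} \<subseteq> {c..n}"
    using \<open>s < c\<close> by auto
  ultimately show "E1 = {e \<in> G. e \<subseteq> {0..s}}" "E2 = {e \<in> G. e \<subseteq> {Suc s..c}}" 
      "E3 = {e \<in> G. e \<subseteq> {c..n}}" 
    unfolding G by blast+
qed

text \<open>All three trees are given on initial segments and rooted at \<open>0\<close>. The second one has \<open>j\<close> edges and is
reflected, which makes its root the node \<open>s + j + 1\<close>; the third one is shifted to the same node.\<close>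

definition glue :: "nat \<Rightarrow> nat \<Rightarrow> nat set set \<Rightarrow> nat set set \<Rightarrow> nat set set \<Rightarrow> nat set set" where
  "glue s j E1 E2 E3 =
     E1 \<union> {{0, Suc (s + j)}} \<union> (`) (\<lambda>v. Suc (s + j) - v) ` E2 \<union> (`) (\<lambda>v. Suc (s + j) + v) ` E3"

lemma reflect_nc_trees_on:
  assumes "j \<le> c" "E \<in> nc_trees_on 0 j"
  shows "(`) (\<lambda>v. c - v) ` E \<in> nc_trees_on (c - j) c"
proof (rule nc_trees_on_image[OF assms(2)])
  show "strict_mono_on {0..j} (\<lambda>v. c - v) \<or> strict_antimono_on {0..j} (\<lambda>v. c - v)"
    using assms(1) by (auto simp: monotone_on_def)
  show "(\<lambda>v. c - v) ` {0..j} = {c - j..c}"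
  proof (intro equalityI subsetI)
    fix v assume "v \<in> {c - j..c}"
    thus "v \<in> (\<lambda>v. c - v) ` {0..j}" using assms(1) by (intro image_eqI[of _ _ "c - v"]) auto
  qed (use assms(1) in auto)
qed

lemma unreflect_nc_trees_on:
  assumes "j \<le> c" "E \<in> nc_trees_on (c - j) c"
  shows "(`) (\<lambda>v. c - v) ` E \<in> nc_trees_on 0 j"
proof (rule nc_trees_on_image[OF assms(2)])
  show "strict_mono_on {c - j..c} (\<lambda>v. c - v) \<or> strict_antimono_on {c - j..c} (\<lambda>v. c - v)"
    using assms(1) by (auto simp: monotone_on_def)
  show "(\<lambda>v. c - v) ` {c - j..c} = {0..j}"
  proof (intro equalityI subsetI)
    fix v assume "v \<in> {0..j}"
    thus "v \<in> (\<lambda>v. c - v) ` {c - j..c}" using assms(1) by (intro image_eqI[of _ _ "c - v"]) auto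
  qed (use assms(1) in auto)
qed

lemma shift_nc_trees_on:
  assumes "E \<in> nc_trees_on 0 k"
  shows "(`) (\<lambda>v. c + v) ` E \<in> nc_trees_on c (c + k)"
  by (rule nc_trees_on_image[OF assms]) (auto simp: monotone_on_def)

lemma unshift_nc_trees_on:
  assumes "E \<in> nc_trees_on c (c + k)"
  shows "(`) (\<lambda>v. v - c) ` E \<in> nc_trees_on 0 k"
proof (rule nc_trees_on_image[OF assms])
  show "(\<lambda>v. v - c) ` {c..c + k} = {0..k}"
  proof (intro equalityI subsetI)
    fix v assume "v \<in> {0..k}"
    thus "v \<in> (\<lambda>v. v - c) ` {c..c + k}" by (intro image_eqI[of _ _ "c + v"]) auto
  qed auto
qed (auto simp: monotone_on_def)

lemma image_image_inverse:
  assumes "edges_in V E" "\<And>v. v \<in> V \<Longrightarrow> g (f v) = v"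
  shows "(`) g ` (`) f ` E = E"
proof -
  have "g ` f ` e = e" if "e \<in> E" for e
    using edges_in_subset[OF assms(1) that] assms(2) by (force simp: image_image)
  thus ?thesis by (simp add: image_image)
qed

lemma nc_trees_on_edges_in: "E \<in> nc_trees_on a b \<Longrightarrow> edges_in {a..b} E"
  by (simp add: nc_trees_on_def tree_on_def)

lemma glue_parts:
  assumes "E1 \<in> nc_trees_on 0 s" "E2 \<in> nc_trees_on 0 j" "E3 \<in> nc_trees_on 0 k"
  shows "(`) (\<lambda>v. Suc (s + j) - v) ` E2 \<in> nc_trees_on (Suc s) (Suc (s + j))"
    and "(`) (\<lambda>v. Suc (s + j) + v) ` E3 \<in> nc_trees_on (Suc (s + j)) (Suc (s + j + k))"
    and "glue s j E1 E2 E3 \<in> nc_trees_on 0 (Suc (s + j + k))"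
proof -
  show 1: "(`) (\<lambda>v. Suc (s + j) - v) ` E2 \<in> nc_trees_on (Suc s) (Suc (s + j))"
    using reflect_nc_trees_on[OF _ assms(2), of "Suc (s + j)"] by simp
  show 2: "(`) (\<lambda>v. Suc (s + j) + v) ` E3 \<in> nc_trees_on (Suc (s + j)) (Suc (s + j + k))"
    using shift_nc_trees_on[OF assms(3), of "Suc (s + j)"] by simp
  show "glue s j E1 E2 E3 \<in> nc_trees_on 0 (Suc (s + j + k))"
    unfolding glue_def by (rule nc_trees_on_glue[OF assms(1) 1 2]) auto
qed

lemma glue_inj:
  assumes E: "E1 \<in> nc_trees_on 0 s" "E2 \<in> nc_trees_on 0 j" "E3 \<in> nc_trees_on 0 k"
    and E': "E1' \<in> nc_trees_on 0 s'" "E2' \<in> nc_trees_on 0 j'" "E3' \<in> nc_trees_on 0 k'"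
    and sum: "s + j + k = s' + j' + k'"
    and eq: "glue s j E1 E2 E3 = glue s' j' E1' E2' E3'"
  shows "s = s' \<and> j = j' \<and> E1 = E1' \<and> E2 = E2' \<and> E3 = E3'"
proof -
  note p = glue_parts[OF E] and p' = glue_parts[OF E']
  note ed = nc_trees_on_edges_in[OF E(1)] nc_trees_on_edges_in[OF p(1)] nc_trees_on_edges_in[OF p(2)]
  note ed' = nc_trees_on_edges_in[OF E'(1)] nc_trees_on_edges_in[OF p'(1)] nc_trees_on_edges_in[OF p'(2)]
  \<comment> \<open>The link is the edge from \<open>0\<close> to its largest neighbour.\<close>
  have nb: "v \<le> Suc (s + j)" 
    if "{0, v} \<in> glue s j E1 E2 E3" and "edges_in {0..s} E1" 
      "edges_in {Suc s..Suc (s + j)} ((`) (\<lambda>v. Suc (s + j) - v) ` E2)" 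
      "edges_in {Suc (s + j)..Suc (s + j + k)} ((`) (\<lambda>v. Suc (s + j) + v) ` E3)"
    for v s j k and E1 E2 E3 :: "nat set set"
    by (rule glued_edge_cases[OF that(2-4) that(1)[unfolded glue_def] subset_refl]) auto
  have "{0, Suc (s + j)} \<in> glue s j E1 E2 E3" "{0, Suc (s' + j')} \<in> glue s' j' E1' E2' E3'"
    by (auto simp: glue_def)
  hence c: "s + j = s' + j'"
    using nb[OF _ ed] nb[OF _ ed'] eq by (metis Suc_le_mono le_antisym)
  hence k: "k = k'" using sum by simp
  let ?c = "Suc (s + j)"
  \<comment> \<open>Removing the link leaves \<open>{0..s}\<close> as the component of \<open>0\<close>.\<close>
  have comp: "conn (glue s j E1 E2 E3 - {{0, Suc (s + j)}}) 0 v \<longleftrightarrow> v \<le> s"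
    if E: "E1 \<in> nc_trees_on 0 s" "E2 \<in> nc_trees_on 0 j" "E3 \<in> nc_trees_on 0 k"
    for v s j k and E1 E2 E3 :: "nat set set"
  proof -
    let ?E2 = "(`) (\<lambda>v. Suc (s + j) - v) ` E2" and ?E3 = "(`) (\<lambda>v. Suc (s + j) + v) ` E3"
    note ed = nc_trees_on_edges_in[OF E(1)] nc_trees_on_edges_in[OF glue_parts(1)[OF E]] 
      nc_trees_on_edges_in[OF glue_parts(2)[OF E]]
    have "{0, Suc (s + j)} \<notin> E1 \<union> ?E2 \<union> ?E3"
      using edges_inD[OF ed(1), of 0 "Suc (s + j)"] edges_inD[OF ed(2), of 0 "Suc (s + j)"] 
        edges_inD[OF ed(3), of 0 "Suc (s + j)"] by auto
    hence G: "glue s j E1 E2 E3 - {{0, Suc (s + j)}} = E1 \<union> {} \<union> ?E2 \<union> ?E3"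
      by (auto simp: glue_def)
    show ?thesis
    proof
      assume "conn (glue s j E1 E2 E3 - {{0, Suc (s + j)}}) 0 v"
      thus "v \<le> s" unfolding G using conn_retract(4)[OF ed, of "{}" 0 v] by simp
    next
      assume "v \<le> s"
      hence "conn E1 0 v" using E(1) by (auto simp: nc_trees_on_def tree_on_def)
      thus "conn (glue s j E1 E2 E3 - {{0, Suc (s + j)}}) 0 v"
        unfolding G by (rule conn_mono[rotated]) auto
    qed
  qed
  have "v \<le> s \<longleftrightarrow> v \<le> s'" for v
    using comp[OF E, of v] comp[OF E', of v] by (simp add: eq c)
  hence s: "s = s'" by (meson le_antisym order_refl)
  hence j: "j = j'" using c by simp
  have eq': "glue s' j' E1 E2 E3 = glue s' j' E1' E2' E3'"
    using eq by (simp add: s j)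
  note r = glue_restrict[OF ed _ glue_def] and r' = glue_restrict[OF ed' _ glue_def]
  have "E1 = E1'" using r(1) r'(1) by (simp add: eq' s j)
  moreover have "(`) (\<lambda>v. ?c - v) ` E2 = (`) (\<lambda>v. ?c - v) ` E2'" 
    using r(2) r'(2) by (simp add: eq' s j k)
  hence "(`) (\<lambda>v. ?c - v) ` (`) (\<lambda>v. ?c - v) ` E2 = (`) (\<lambda>v. ?c - v) ` (`) (\<lambda>v. ?c - v) ` E2'" 
    by simp
  hence "E2 = E2'"
    using image_image_inverse[OF nc_trees_on_edges_in[OF E(2)], of "\<lambda>v. ?c - v" "\<lambda>v. ?c - v"]
      image_image_inverse[OF nc_trees_on_edges_in[OF E'(2)], of "\<lambda>v. ?c - v" "\<lambda>v. ?c - v"] j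
    by simp
  moreover have "(`) (\<lambda>v. ?c + v) ` E3 = (`) (\<lambda>v. ?c + v) ` E3'" 
    using r(3) r'(3) by (simp add: eq' s j k)
  hence "(`) (\<lambda>v. v - ?c) ` (`) (\<lambda>v. ?c + v) ` E3 = (`) (\<lambda>v. v - ?c) ` (`) (\<lambda>v. ?c + v) ` E3'" 
    by simp
  hence "E3 = E3'"
    using image_image_inverse[OF nc_trees_on_edges_in[OF E(3)], of "\<lambda>v. v - ?c" "\<lambda>v. ?c + v"]
      image_image_inverse[OF nc_trees_on_edges_in[OF E'(3)], of "\<lambda>v. v - ?c" "\<lambda>v. ?c + v"] 
    by simp
  ultimately show ?thesis using s j by simp
qed

lemma glue_surj:
  assumes "E \<in> nc_trees_on 0 (Suc m)"
  obtains s j k E1 E2 E3 where "s + j + k = m" "E1 \<in> nc_trees_on 0 s" "E2 \<in> nc_trees_on 0 j"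
    "E3 \<in> nc_trees_on 0 k" "E = glue s j E1 E2 E3"
proof -
  obtain s c where sc: "s < c" "c \<le> Suc m"
    and eq: "E = {e \<in> E. e \<subseteq> {0..s}} \<union> {{0, c}} \<union> {e \<in> E. e \<subseteq> {Suc s..c}} \<union> {e \<in> E. e \<subseteq> {c..Suc m}}"
    and 1: "{e \<in> E. e \<subseteq> {0..s}} \<in> nc_trees_on 0 s"
    and 2: "{e \<in> E. e \<subseteq> {Suc s..c}} \<in> nc_trees_on (Suc s) c"
    and 3: "{e \<in> E. e \<subseteq> {c..Suc m}} \<in> nc_trees_on c (Suc m)"
    using nc_trees_on_decompose[OF assms] by blast
  define j k where "j = c - Suc s" and "k = Suc m - c"
  have c: "c = Suc (s + j)" and k: "Suc m = c + k" using sc by (auto simp: j_def k_def)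
  define E2 where "E2 = (`) (\<lambda>v. c - v) ` {e \<in> E. e \<subseteq> {Suc s..c}}"
  define E3 where "E3 = (`) (\<lambda>v. v - c) ` {e \<in> E. e \<subseteq> {c..Suc m}}"
  have "E2 \<in> nc_trees_on 0 j"
    unfolding E2_def by (rule unreflect_nc_trees_on) (use 2 in \<open>simp_all add: c\<close>)
  moreover have "E3 \<in> nc_trees_on 0 k"
    unfolding E3_def by (rule unshift_nc_trees_on) (use 3 in \<open>simp add: k\<close>)
  moreover have "E = glue s j {e \<in> E. e \<subseteq> {0..s}} E2 E3"
  proof -
    have "(`) (\<lambda>v. c - v) ` E2 = {e \<in> E. e \<subseteq> {Suc s..c}}"
      unfolding E2_def by (rule image_image_inverse[OF nc_trees_on_edges_in[OF 2]]) auto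
    moreover have "(`) (\<lambda>v. c + v) ` E3 = {e \<in> E. e \<subseteq> {c..Suc m}}"
      unfolding E3_def by (rule image_image_inverse[OF nc_trees_on_edges_in[OF 3]]) auto
    ultimately show ?thesis unfolding glue_def c[symmetric] using eq by simp
  qed
  moreover have "s + j + k = m" using c k by simp
  ultimately show ?thesis using that 1 by blast
qed

unbundle no vec_syntax

section \<open>The depth of a node in a glued tree\<close>

lemma depth_eqI:
  assumes E: "E \<in> noncrossing_trees n" and p: "is_path {0..n} E 0 v p"
  shows "depth n E v = length p - 1"
  unfolding depth_def
proof (rule the_equality)
  have br: "all_bridges E" using E by (simp add: noncrossing_trees_eq nc_trees_on_def tree_on_def)
  show "\<exists>q. is_path {0..n} E 0 v q \<and> length q = length p - 1 + 1"
    using p by (intro exI[of _ p]) (auto simp: is_path_def Suc_le_eq)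
  fix k assume "\<exists>q. is_path {0..n} E 0 v q \<and> length q = k + 1"
  then obtain q where q: "is_path {0..n} E 0 v q" "length q = k + 1" by blast
  have "p = q" 
    by (rule distinct_walk_unique[OF br]) (use p q(1) in \<open>simp_all add: is_path_def\<close>)
  thus "k = length p - 1" using q by simp
qed

lemma depth_path:
  assumes E: "E \<in> noncrossing_trees n" and v: "v \<le> n"
  obtains p where "is_path {0..n} E 0 v p" "length p = Suc (depth n E v)"
proof -
  have "\<forall>u\<in>{0..n}. \<forall>v\<in>{0..n}. \<exists>p. is_path {0..n} E u v p" 
    using E unfolding noncrossing_trees_def is_tree_def by blast
  then obtain p where p: "is_path {0..n} E 0 v p"
    using v by (metis atLeastAtMost_iff le0)
  have "length p = Suc (depth n E v)"
    using depth_eqI[OF E p] p by (cases p) (auto simp: is_path_def)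
  thus ?thesis using p that by blast
qed

lemma depth_eq_0_iff:
  assumes E: "E \<in> noncrossing_trees n" and v: "v \<le> n"
  shows "depth n E v = 0 \<longleftrightarrow> v = 0"
proof
  assume "depth n E v = 0"
  then obtain p where "is_path {0..n} E 0 v p" "length p = 1" using depth_path[OF E v] by auto
  thus "v = 0" by (cases p) (auto simp: is_path_def)
next
  assume "v = 0"
  hence "is_path {0..n} E 0 v [0]" by (simp add: is_path_def)
  from depth_eqI[OF E this] show "depth n E v = 0" by simp
qed

lemma is_path_map:
  assumes p: "is_path V E u v p" and f: "inj_on f V" "f ` V \<subseteq> W" "(`) f ` E \<subseteq> E'"
  shows "is_path W E' (f u) (f v) (map f p)"
proof -
  have ne: "p \<noteq> []" and ends: "hd p = u" "last p = v" and set: "set p \<subseteq> V"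
    and dist: "distinct p" and succ: "successively (\<lambda>a b. {a, b} \<in> E) p"
    using p by (simp_all add: is_path_def)
  have "{f a, f b} \<in> E'" if "{a, b} \<in> E" for a b
    using that f(3) by (intro subsetD[OF f(3)] image_eqI[of _ _ "{a, b}"]) auto
  hence "successively (\<lambda>a b. {f a, f b} \<in> E') p"
    by (intro successively_mono[OF succ])
  moreover have "inj_on f (set p)" using f(1) set by (rule inj_on_subset)
  moreover have "f ` set p \<subseteq> W" using f(2) set by blast
  ultimately show ?thesis
    using ne dist by (simp add: is_path_def successively_map distinct_map hd_map last_map ends)
qed

lemma depth_glue:
  assumes E: "E1 \<in> noncrossing_trees s" "E2 \<in> noncrossing_trees j" "E3 \<in> noncrossing_trees k"
    and c: "c = Suc (s + j)" and n: "n = c + k"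
  defines "G \<equiv> glue s j E1 E2 E3"
  shows "G \<in> noncrossing_trees n"
    and "v \<le> s \<Longrightarrow> depth n G v = depth s E1 v"
    and "v \<le> j \<Longrightarrow> depth n G (c - v) = Suc (depth j E2 v)"
    and "v \<le> k \<Longrightarrow> depth n G (c + v) = Suc (depth k E3 v)"
proof -
  show G: "G \<in> noncrossing_trees n"
    using glue_parts(3)[of E1 s E2 j E3 k] E unfolding noncrossing_trees_eq G_def n c by simp
  show "depth n G v = depth s E1 v" if "v \<le> s"
  proof -
    obtain p where p: "is_path {0..s} E1 0 v p" "length p = Suc (depth s E1 v)"
      using depth_path[OF E(1) \<open>v \<le> s\<close>] .
    have "is_path {0..n} G 0 v (map (\<lambda>v. v) p)"
      by (rule is_path_map[OF p(1)]) (auto simp: n c G_def glue_def)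
    from depth_eqI[OF G this] p(2) show ?thesis by simp
  qed
  have link: "{0, c} \<in> G" by (simp add: G_def glue_def c)
  \<comment> \<open>A path below \<open>c\<close> is prolonged by the edge from \<open>0\<close> to \<open>c\<close>.\<close>
  have prolong: "is_path {0..n} G 0 v (0 # p)" if "is_path {1..n} G c v p" for v p
    using that link by (cases p) (auto simp: is_path_def)
  show "depth n G (c - v) = Suc (depth j E2 v)" if "v \<le> j"
  proof -
    obtain p where p: "is_path {0..j} E2 0 v p" "length p = Suc (depth j E2 v)"
      using depth_path[OF E(2) \<open>v \<le> j\<close>] .
    have "is_path {1..n} G (c - 0) (c - v) (map (\<lambda>v. c - v) p)"
      by (rule is_path_map[OF p(1)]) (auto simp: n c G_def glue_def inj_on_def)
    hence "is_path {0..n} G 0 (c - v) (0 # map (\<lambda>v. c - v) p)" by (intro prolong) simp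
    from depth_eqI[OF G this] p(2) show ?thesis by simp
  qed
  show "depth n G (c + v) = Suc (depth k E3 v)" if "v \<le> k"
  proof -
    obtain p where p: "is_path {0..k} E3 0 v p" "length p = Suc (depth k E3 v)"
      using depth_path[OF E(3) \<open>v \<le> k\<close>] .
    have "is_path {1..n} G (c + 0) (c + v) (map (\<lambda>v. c + v) p)"
      by (rule is_path_map[OF p(1)]) (auto simp: n c G_def glue_def inj_on_def)
    hence "is_path {0..n} G 0 (c + v) (0 # map (\<lambda>v. c + v) p)" by (intro prolong) simp
    from depth_eqI[OF G this] p(2) show ?thesis by simp
  qed
qed

section \<open>Generating functions of the nodes at a given depth\<close>

lemma finite_noncrossing_trees [simp, intro]: "finite (noncrossing_trees n)"
proof (rule finite_subset)
  show "noncrossing_trees n \<subseteq> Pow (Pow {0..n})"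
    using nc_trees_on_edges_in[of _ 0 n] edges_in_subset[of "{0..n}"]
    unfolding noncrossing_trees_eq by blast
qed simp

lemma noncrossing_trees_0: "noncrossing_trees 0 = {{}}"
proof -
  have "{} \<in> noncrossing_trees 0"
    unfolding noncrossing_trees_eq nc_trees_on_def crossing_free_def
    by (auto intro!: tree_onI[of _ _ 0] simp: edges_in_def all_bridges_def)
  moreover have "E = {}" if "E \<in> noncrossing_trees 0" for E
    using nc_trees_on_edges_in[of E 0 0] that by (auto simp: noncrossing_trees_eq edges_in_def)
  ultimately show ?thesis by auto
qed

text \<open>The sum over \<open>s\<close> and \<open>j\<close> with third size \<open>m - s - j\<close> has the shape of a coefficient of a product of
three power series, which turns statistics that are additive over the parts into equations
between generating functions.\<close>

lemma sum_noncrossing_trees_Suc: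
  fixes F :: "nat set set \<Rightarrow> 'a :: comm_monoid_add"
  shows "(\<Sum>E\<in>noncrossing_trees (Suc m). F E) =
    (\<Sum>s=0..m. \<Sum>j=0..m-s. \<Sum>E1\<in>noncrossing_trees s. \<Sum>E2\<in>noncrossing_trees j.
       \<Sum>E3\<in>noncrossing_trees (m - s - j). F (glue s j E1 E2 E3))"
proof -
  define S where "S = (SIGMA s:{0..m}. SIGMA j:{0..m-s}. 
    SIGMA E1:noncrossing_trees s. SIGMA E2:noncrossing_trees j. noncrossing_trees (m - s - j))"
  have "bij_betw (\<lambda>(s, j, E1, E2, E3). glue s j E1 E2 E3) S (noncrossing_trees (Suc m))"
    unfolding bij_betw_def
  proof
    show "inj_on (\<lambda>(s, j, E1, E2, E3). glue s j E1 E2 E3) S"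
    proof (rule inj_onI)
      fix p p' assume "p \<in> S" "p' \<in> S"
        and eq: "(\<lambda>(s, j, E1, E2, E3). glue s j E1 E2 E3) p = (\<lambda>(s, j, E1, E2, E3). glue s j E1 E2 E3) p'"
      moreover obtain s j E1 E2 E3 s' j' E1' E2' E3' 
        where p: "p = (s, j, E1, E2, E3)" "p' = (s', j', E1', E2', E3')"
        by (metis prod_cases5)
      ultimately have "s = s' \<and> j = j' \<and> E1 = E1' \<and> E2 = E2' \<and> E3 = E3'"
        by (intro glue_inj[of _ _ _ _ _ "m - s - j" _ _ _ _ _ "m - s' - j'"])
          (auto simp: S_def noncrossing_trees_eq)
      thus "p = p'" by (simp add: p)
    qed
    show "(\<lambda>(s, j, E1, E2, E3). glue s j E1 E2 E3) ` S = noncrossing_trees (Suc m)"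
    proof (intro equalityI subsetI)
      fix E assume "E \<in> (\<lambda>(s, j, E1, E2, E3). glue s j E1 E2 E3) ` S"
      then obtain s j E1 E2 E3 where "s \<le> m" "j \<le> m - s" "E = glue s j E1 E2 E3"
          "E1 \<in> noncrossing_trees s" "E2 \<in> noncrossing_trees j" "E3 \<in> noncrossing_trees (m - s - j)"
        by (auto simp: S_def)
      thus "E \<in> noncrossing_trees (Suc m)"
        using glue_parts(3)[of E1 s E2 j E3 "m - s - j"] by (simp add: noncrossing_trees_eq)
    next
      fix E assume "E \<in> noncrossing_trees (Suc m)"
      then obtain s j k E1 E2 E3 where *: "s + j + k = m" "E1 \<in> noncrossing_trees s"
          "E2 \<in> noncrossing_trees j" "E3 \<in> noncrossing_trees k" "E = glue s j E1 E2 E3"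
        unfolding noncrossing_trees_eq by (rule glue_surj)
      have "k = m - s - j" using *(1) by simp
      hence "(s, j, E1, E2, E3) \<in> S" using * by (auto simp: S_def)
      thus "E \<in> (\<lambda>(s, j, E1, E2, E3). glue s j E1 E2 E3) ` S" using *(5) by force
    qed
  qed
  from sum.reindex_bij_betw[OF this, of F] show ?thesis
    unfolding S_def by (simp add: sum.Sigma split_def)
qed

definition depth_sum :: "nat \<Rightarrow> nat \<Rightarrow> (nat \<Rightarrow> 'a) \<Rightarrow> 'a :: comm_ring_1" where
  "depth_sum n d f = (\<Sum>E\<in>noncrossing_trees n. \<Sum>v | v \<le> n \<and> depth n E v = d. f v)"

abbreviation nc_count :: "nat \<Rightarrow> 'a :: comm_ring_1" where
  "nc_count n \<equiv> of_nat (card (noncrossing_trees n))"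

lemma nc_count_Suc:
  "(nc_count (Suc m) :: 'a :: comm_ring_1) =
     (\<Sum>s=0..m. \<Sum>j=0..m-s. nc_count s * nc_count j * nc_count (m - s - j))"
  using sum_noncrossing_trees_Suc[of "\<lambda>_. 1 :: 'a" m] by (simp add: mult_ac)

lemma depth_sum_0: "depth_sum n 0 f = nc_count n * f 0"
proof -
  have "{v. v \<le> n \<and> depth n E v = 0} = {0}" if "E \<in> noncrossing_trees n" for E
    using depth_eq_0_iff[OF that] by auto
  thus ?thesis by (simp add: depth_sum_def)
qed

lemma depth_sum_0_Suc: "depth_sum 0 (Suc d) f = 0"
proof -
  have "depth 0 {} 0 = 0" using depth_eq_0_iff[of "{}" 0 0] by (simp add: noncrossing_trees_0)
  hence empty: "{v. v \<le> 0 \<and> depth 0 {} v = Suc d} = {}" by auto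
  have "depth_sum 0 (Suc d) f = sum f {v. v \<le> 0 \<and> depth 0 {} v = Suc d}"
    by (simp add: depth_sum_def noncrossing_trees_0)
  thus ?thesis unfolding empty by simp
qed

text \<open>The node \<open>s + j + 1\<close> is the root both of the second and of the third part. It is counted with the
second one; for \<open>d = 0\<close> nothing remains to be counted in the third part, since the root is its only
node of depth \<open>0\<close>.\<close>

lemma sum_depth_glue:
  assumes E: "E1 \<in> noncrossing_trees s" "E2 \<in> noncrossing_trees j" "E3 \<in> noncrossing_trees k"
    and c: "c = Suc (s + j)" and n: "n = c + k"
  shows "(\<Sum>v | v \<le> n \<and> depth n (glue s j E1 E2 E3) v = Suc d. f v) =
    (\<Sum>v | v \<le> s \<and> depth s E1 v = Suc d. f v) + (\<Sum>v | v \<le> j \<and> depth j E2 v = d. f (c - v)) +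
    (if d = 0 then 0 else \<Sum>v | v \<le> k \<and> depth k E3 v = d. f (c + v) :: 'a :: comm_monoid_add)"
proof -
  note dg = depth_glue[OF E c n]
  define G where "G = glue s j E1 E2 E3"
  define A where "A = {v. v \<le> s \<and> depth s E1 v = Suc d}"
  define B where "B = {v. v \<le> j \<and> depth j E2 v = d}"
  define C where "C = {v. v \<le> k \<and> v \<noteq> 0 \<and> depth k E3 v = d}"
  have "{v. v \<le> n \<and> depth n G v = Suc d} = A \<union> (\<lambda>v. c - v) ` B \<union> (\<lambda>v. c + v) ` C"
  proof (intro equalityI subsetI)
    fix v assume v: "v \<in> {v. v \<le> n \<and> depth n G v = Suc d}"
    consider "v \<le> s" | "s < v" "v \<le> c" | "c < v" by linarith
    thus "v \<in> A \<union> (\<lambda>v. c - v) ` B \<union> (\<lambda>v. c + v) ` C"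
    proof cases
      case 1
      thus ?thesis using v dg(2) by (auto simp: A_def G_def)
    next
      case 2
      hence "c - v \<in> B" "v = c - (c - v)" using v dg(3)[of "c - v"] by (auto simp: B_def G_def c)
      thus ?thesis by blast
    next
      case 3
      hence "v - c \<in> C" "v = c + (v - c)" using v dg(4)[of "v - c"] by (auto simp: C_def G_def n)
      thus ?thesis by blast
    qed
  next
    fix v assume "v \<in> A \<union> (\<lambda>v. c - v) ` B \<union> (\<lambda>v. c + v) ` C"
    thus "v \<in> {v. v \<le> n \<and> depth n G v = Suc d}"
      using dg(2-4) by (auto simp: A_def B_def C_def G_def n c)
  qed
  hence "(\<Sum>v | v \<le> n \<and> depth n G v = Suc d. f v) = sum f (A \<union> (\<lambda>v. c - v) ` B \<union> (\<lambda>v. c + v) ` C)"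
    by simp
  also have "\<dots> = sum f A + sum f ((\<lambda>v. c - v) ` B) + sum f ((\<lambda>v. c + v) ` C)"
  proof -
    have fin: "finite A" "finite B" "finite C" by (auto simp: A_def B_def C_def)
    have "A \<inter> (\<lambda>v. c - v) ` B = {}" "(A \<union> (\<lambda>v. c - v) ` B) \<inter> (\<lambda>v. c + v) ` C = {}"
      by (auto simp: A_def B_def C_def c)
    thus ?thesis using fin by (simp add: sum.union_disjoint)
  qed
  also have "sum f ((\<lambda>v. c - v) ` B) = (\<Sum>v\<in>B. f (c - v))"
    by (subst sum.reindex) (auto simp: inj_on_def B_def c)
  also have "sum f ((\<lambda>v. c + v) ` C) = (\<Sum>v\<in>C. f (c + v))"
    by (subst sum.reindex) (auto simp: inj_on_def)
  also have "(\<Sum>v\<in>C. f (c + v)) = (if d = 0 then 0 else \<Sum>v | v \<le> k \<and> depth k E3 v = d. f (c + v))"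
  proof (cases "d = 0")
    case True
    hence "C = {}" using depth_eq_0_iff[OF E(3)] by (auto simp: C_def)
    thus ?thesis using True by simp
  next
    case False
    have "depth k E3 0 = 0" using depth_eq_0_iff[OF E(3), of 0] by simp
    hence "v \<noteq> 0" if "depth k E3 v = d" for v using False that by (cases v) auto
    hence "C = {v. v \<le> k \<and> depth k E3 v = d}" using False by (auto simp: C_def)
    thus ?thesis using False by simp
  qed
  finally show ?thesis unfolding A_def B_def G_def .
qed

lemma sum3_separated:
  fixes a :: "'b \<Rightarrow> 'a :: comm_ring_1"
  shows "(\<Sum>x\<in>A. \<Sum>y\<in>B. \<Sum>z\<in>C. a x + b y + c z) =
    sum a A * of_nat (card B) * of_nat (card C) + of_nat (card A) * sum b B * of_nat (card C) 
    + of_nat (card A) * of_nat (card B) * sum c C"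
  by (simp add: sum.distrib flip: sum_distrib_left sum_distrib_right) (simp add: algebra_simps)

lemma depth_sum_Suc:
  fixes f :: "nat \<Rightarrow> 'a :: comm_ring_1"
  shows "depth_sum (Suc m) (Suc d) f = (\<Sum>s=0..m. \<Sum>j=0..m-s.
     depth_sum s (Suc d) f * nc_count j * nc_count (m - s - j) +
     nc_count s * depth_sum j d (\<lambda>v. f (Suc (s + j) - v)) * nc_count (m - s - j) +
     (if d = 0 then 0 else 
       nc_count s * nc_count j * depth_sum (m - s - j) d (\<lambda>v. f (Suc (s + j) + v))))"
proof -
  have "depth_sum (Suc m) (Suc d) f = (\<Sum>s=0..m. \<Sum>j=0..m-s. 
      \<Sum>E1\<in>noncrossing_trees s. \<Sum>E2\<in>noncrossing_trees j. \<Sum>E3\<in>noncrossing_trees (m - s - j).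
        (\<Sum>v | v \<le> s \<and> depth s E1 v = Suc d. f v) 
        + (\<Sum>v | v \<le> j \<and> depth j E2 v = d. f (Suc (s + j) - v)) 
        + (if d = 0 then 0 else \<Sum>v | v \<le> m-s-j \<and> depth (m-s-j) E3 v = d. f (Suc (s + j) + v)))"
    unfolding depth_sum_def sum_noncrossing_trees_Suc
    by (intro sum.cong refl sum_depth_glue) auto
  also have "\<dots> = (\<Sum>s=0..m. \<Sum>j=0..m-s.
     depth_sum s (Suc d) f * nc_count j * nc_count (m - s - j) +
     nc_count s * depth_sum j d (\<lambda>v. f (Suc (s + j) - v)) * nc_count (m - s - j) +
     (if d = 0 then 0 else 
       nc_count s * nc_count j * depth_sum (m - s - j) d (\<lambda>v. f (Suc (s + j) + v))))"
    unfolding sum3_separated by (intro sum.cong refl) (simp add: depth_sum_def)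
  finally show ?thesis .
qed


text \<open>The series \<open>T(q z)\<close>.\<close>

definition nc_gf :: "'a :: comm_ring_1 \<Rightarrow> 'a fps" where
  "nc_gf q = Abs_fps (\<lambda>n. nc_count n * q ^ n)"

text \<open>The ring element \<open>q\<close> plays the role of the variable \<open>x\<close>. Weighting a node by its distance
from the last node, as in \<open>mirror_depth_gf\<close>, accounts for the reflected part.\<close>

definition depth_gf :: "'a :: comm_ring_1 \<Rightarrow> nat \<Rightarrow> 'a fps" where
  "depth_gf q d = Abs_fps (\<lambda>n. depth_sum n d (\<lambda>v. q ^ v))"

definition mirror_depth_gf :: "'a :: comm_ring_1 \<Rightarrow> nat \<Rightarrow> 'a fps" where
  "mirror_depth_gf q d = Abs_fps (\<lambda>n. depth_sum n d (\<lambda>v. q ^ (n - v)))"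

lemma fps_mult3_nth:
  "(F * (G * H)) $ m = (\<Sum>s=0..m. \<Sum>j=0..m-s. F $ s * G $ j * H $ (m - s - j))"
  for F G H :: "'a :: comm_ring_1 fps"
  by (simp add: fps_mult_nth sum_distrib_left mult_ac)

lemma fps_eqI_Suc:
  fixes F G :: "'a :: zero fps"
  assumes "F $ 0 = G $ 0" "\<And>m. F $ Suc m = G $ Suc m"
  shows "F = G"
  by (rule fps_ext) (metis assms not0_implies_Suc)

lemma nc_gf_eq: "nc_gf q = 1 + fps_const q * fps_X * nc_gf q ^ 3"
proof (rule fps_eqI_Suc)
  fix m
  have "nc_gf q $ Suc m = q * (\<Sum>s=0..m. \<Sum>j=0..m-s. 
          (nc_count s * q ^ s) * (nc_count j * q ^ j) * (nc_count (m - s - j) * q ^ (m - s - j)))"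
    unfolding nc_gf_def fps_nth_Abs_fps nc_count_Suc sum_distrib_left sum_distrib_right
  proof (intro sum.cong refl)
    fix s j assume "s \<in> {0..m}" "j \<in> {0..m-s}"
    hence "Suc m = Suc (s + j + (m - s - j))" by simp
    hence "q ^ Suc m = q * q ^ s * q ^ j * q ^ (m - s - j)" by (metis power_Suc power_add mult.assoc)
    thus "nc_count s * nc_count j * nc_count (m - s - j) * q ^ Suc m =
       q * (nc_count s * q ^ s * (nc_count j * q ^ j) * (nc_count (m - s - j) * q ^ (m - s - j)))"
      by (simp add: mult_ac)
  qed
  also have "\<dots> = q * (nc_gf q * (nc_gf q * nc_gf q)) $ m"
    unfolding fps_mult3_nth by (simp add: nc_gf_def)
  also have "\<dots> = (1 + fps_const q * (fps_X * (nc_gf q * (nc_gf q * nc_gf q)))) $ Suc m"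
    by (simp del: fps_mult_nth_0)
  finally show "nc_gf q $ Suc m = (1 + fps_const q * fps_X * nc_gf q ^ 3) $ Suc m"
    by (simp add: power3_eq_cube mult.assoc)
qed (simp add: nc_gf_def noncrossing_trees_0)

lemma depth_sum_scale: "depth_sum n d (\<lambda>v. c * f v) = c * depth_sum n d f"
  by (simp add: depth_sum_def sum_distrib_left)

lemma depth_sum_cong: "(\<And>v. v \<le> n \<Longrightarrow> f v = g v) \<Longrightarrow> depth_sum n d f = depth_sum n d g"
  unfolding depth_sum_def by (intro sum.cong refl) auto

lemma depth_sum_eq_scale:
  "(\<And>v. v \<le> n \<Longrightarrow> f v = c * g v) \<Longrightarrow> depth_sum n d f = c * depth_sum n d g"
  using depth_sum_cong[of n f "\<lambda>v. c * g v"] by (simp add: depth_sum_scale)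

lemma depth_gf_Suc:
  "depth_gf q (Suc d) = fps_X * (nc_gf 1 ^ 2 * depth_gf q (Suc d)
     + fps_const q * nc_gf 1 * nc_gf q * mirror_depth_gf q d
     + (if d = 0 then 0 else fps_const q * nc_gf q ^ 2 * depth_gf q d))"
proof (rule fps_eqI_Suc)
  fix m
  define S where "S = (if d = 0 then 0 else 1 :: 'a)"
  let ?T = "nc_gf 1 :: 'a fps" and ?t = "nc_gf q" and ?D = "depth_gf q" and ?L = "mirror_depth_gf q"
  have "?D (Suc d) $ Suc m = (\<Sum>s=0..m. \<Sum>j=0..m-s. 
      ?D (Suc d) $ s * ?T $ j * ?T $ (m - s - j) 
      + q * (?t $ s * ?L d $ j * ?T $ (m - s - j))
      + S * q * (?t $ s * ?t $ j * ?D d $ (m - s - j)))"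
    unfolding depth_gf_def mirror_depth_gf_def nc_gf_def fps_nth_Abs_fps depth_sum_Suc
  proof (intro sum.cong refl arg_cong2[of _ _ _ _ "(+)"])
    fix s j assume sj: "s \<in> {0..m}" "j \<in> {0..m-s}"
    show "depth_sum s (Suc d) (\<lambda>v. q ^ v) * nc_count j * nc_count (m - s - j) =
      depth_sum s (Suc d) (\<lambda>v. q ^ v) * (nc_count j * 1 ^ j) * (nc_count (m - s - j) * 1 ^ (m - s - j))"
      by simp
    have "depth_sum j d (\<lambda>v. q ^ (Suc (s + j) - v)) = q ^ Suc s * depth_sum j d (\<lambda>v. q ^ (j - v))"
      by (rule depth_sum_eq_scale, unfold power_add[symmetric], rule arg_cong[of _ _ "power q"]) arith
    thus "nc_count s * depth_sum j d (\<lambda>v. q ^ (Suc (s + j) - v)) * nc_count (m - s - j) =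
      q * (nc_count s * q ^ s * depth_sum j d (\<lambda>v. q ^ (j - v)) * (nc_count (m - s - j) * 1 ^ (m - s - j)))"
      by (simp add: mult_ac)
    have "depth_sum (m - s - j) d (\<lambda>v. q ^ (Suc (s + j) + v)) = 
        q ^ Suc (s + j) * depth_sum (m - s - j) d (\<lambda>v. q ^ v)"
      by (rule depth_sum_eq_scale) (simp add: power_add)
    thus "(if d = 0 then 0 else nc_count s * nc_count j * 
          depth_sum (m - s - j) d (\<lambda>v. q ^ (Suc (s + j) + v))) =
       S * q * (nc_count s * q ^ s * (nc_count j * q ^ j) * depth_sum (m - s - j) d (\<lambda>v. q ^ v))"
      by (simp add: S_def mult_ac power_add)
  qed
  also have "\<dots> = (?D (Suc d) * (?T * ?T) + fps_const q * (?t * (?L d * ?T)) 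
      + fps_const (S * q) * (?t * (?t * ?D d))) $ m"
    unfolding fps_add_nth fps_mult_left_const_nth
    unfolding fps_mult3_nth by (simp only: sum.distrib sum_distrib_left)
  also have "?D (Suc d) * (?T * ?T) + fps_const q * (?t * (?L d * ?T)) 
      + fps_const (S * q) * (?t * (?t * ?D d)) =
      ?T ^ 2 * ?D (Suc d) + fps_const q * ?T * ?t * ?L d
      + (if d = 0 then 0 else fps_const q * ?t ^ 2 * ?D d)"
    by (simp add: S_def power2_eq_square mult_ac)
  finally show "?D (Suc d) $ Suc m = (fps_X * (?T ^ 2 * ?D (Suc d) + fps_const q * ?T * ?t * ?L d
      + (if d = 0 then 0 else fps_const q * ?t ^ 2 * ?D d))) $ Suc m"
    by simp
qed (simp add: depth_gf_def depth_sum_0_Suc)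

lemma mirror_depth_gf_Suc:
  "mirror_depth_gf q (Suc d) = fps_X * (fps_const q * nc_gf q ^ 2 * mirror_depth_gf q (Suc d)
     + nc_gf 1 * nc_gf q * depth_gf q d
     + (if d = 0 then 0 else nc_gf 1 ^ 2 * mirror_depth_gf q d))"
proof (rule fps_eqI_Suc)
  fix m
  define S where "S = (if d = 0 then 0 else 1 :: 'a)"
  let ?T = "nc_gf 1 :: 'a fps" and ?t = "nc_gf q" and ?D = "depth_gf q" and ?L = "mirror_depth_gf q"
  have "?L (Suc d) $ Suc m = (\<Sum>s=0..m. \<Sum>j=0..m-s. 
      q * (?L (Suc d) $ s * ?t $ j * ?t $ (m - s - j))
      + ?T $ s * ?D d $ j * ?t $ (m - s - j)
      + S * (?T $ s * ?T $ j * ?L d $ (m - s - j)))"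
    unfolding depth_gf_def mirror_depth_gf_def nc_gf_def fps_nth_Abs_fps depth_sum_Suc
  proof (intro sum.cong refl arg_cong2[of _ _ _ _ "(+)"])
    fix s j assume sj: "s \<in> {0..m}" "j \<in> {0..m-s}"
    define k where "k = m - s - j"
    have m: "m = s + j + k" using sj by (simp add: k_def)
    have "depth_sum s (Suc d) (\<lambda>v. q ^ (Suc m - v)) = 
        q ^ Suc (j + k) * depth_sum s (Suc d) (\<lambda>v. q ^ (s - v))"
      by (rule depth_sum_eq_scale, unfold power_add[symmetric] m, rule arg_cong[of _ _ "power q"]) arith
    thus "depth_sum s (Suc d) (\<lambda>v. q ^ (Suc m - v)) * nc_count j * nc_count (m - s - j) =
      q * (depth_sum s (Suc d) (\<lambda>v. q ^ (s - v)) * (nc_count j * q ^ j) * 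
        (nc_count (m - s - j) * q ^ (m - s - j)))"
      unfolding k_def[symmetric] by (simp add: mult_ac power_add)
    have "depth_sum j d (\<lambda>v. q ^ (Suc m - (Suc (s + j) - v))) = q ^ k * depth_sum j d (\<lambda>v. q ^ v)"
      by (rule depth_sum_eq_scale) (simp add: m flip: power_add)
    thus "nc_count s * depth_sum j d (\<lambda>v. q ^ (Suc m - (Suc (s + j) - v))) * nc_count (m - s - j) =
      nc_count s * 1 ^ s * depth_sum j d (\<lambda>v. q ^ v) * (nc_count (m - s - j) * q ^ (m - s - j))"
      unfolding k_def[symmetric] by (simp add: mult_ac)
    have "depth_sum k d (\<lambda>v. q ^ (Suc m - (Suc (s + j) + v))) = depth_sum k d (\<lambda>v. q ^ (k - v))"
      by (rule depth_sum_cong) (simp add: m)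
    thus "(if d = 0 then 0 else nc_count s * nc_count j * 
          depth_sum (m - s - j) d (\<lambda>v. q ^ (Suc m - (Suc (s + j) + v)))) =
       S * (nc_count s * 1 ^ s * (nc_count j * 1 ^ j) * 
          depth_sum (m - s - j) d (\<lambda>v. q ^ (m - s - j - v)))"
      unfolding k_def[symmetric] by (simp add: S_def)
  qed
  also have "\<dots> = (fps_const q * (?L (Suc d) * (?t * ?t)) + ?T * (?D d * ?t) 
      + fps_const S * (?T * (?T * ?L d))) $ m"
    unfolding fps_add_nth fps_mult_left_const_nth
    unfolding fps_mult3_nth by (simp only: sum.distrib sum_distrib_left)
  also have "fps_const q * (?L (Suc d) * (?t * ?t)) + ?T * (?D d * ?t) 
      + fps_const S * (?T * (?T * ?L d)) =
      fps_const q * ?t ^ 2 * ?L (Suc d) + ?T * ?t * ?D d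
      + (if d = 0 then 0 else ?T ^ 2 * ?L d)"
    by (simp add: S_def power2_eq_square mult_ac)
  finally show "?L (Suc d) $ Suc m = (fps_X * (fps_const q * ?t ^ 2 * ?L (Suc d) + ?T * ?t * ?D d
      + (if d = 0 then 0 else ?T ^ 2 * ?L d))) $ Suc m"
    by simp
qed (simp add: mirror_depth_gf_def depth_sum_0_Suc)

lemma depth_gf_0: "depth_gf q 0 = nc_gf 1" and mirror_depth_gf_0: "mirror_depth_gf q 0 = nc_gf q"
  by (simp_all add: depth_gf_def mirror_depth_gf_def nc_gf_def depth_sum_0)

text \<open>Since \<open>t (1 - w t^2) = 1\<close>, the series \<open>t\<close> itself is the geometric factor \<open>1 / (1 - w t^2)\<close>.\<close>

lemma geometric_solution:
  fixes F G t w :: "'a :: comm_ring_1"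
  assumes "t = 1 + w * t ^ 3" and "F = w * t ^ 2 * F + G"
  shows "F = t * G"
proof -
  have "G = F - w * t ^ 2 * F" using assms(2) by (simp add: algebra_simps)
  hence "t * G = t * (F - w * t ^ 2 * F)" by (rule arg_cong)
  also have "\<dots> = F * (t - w * t ^ 3)" 
    by (simp add: algebra_simps power2_eq_square power3_eq_cube)
  also have "t - w * t ^ 3 = 1" using assms(1) by (simp add: algebra_simps)
  finally show ?thesis by simp
qed

lemma depth_gf_rec:
  fixes q :: "'a :: comm_ring_1"
  defines "T \<equiv> nc_gf 1" and "t \<equiv> nc_gf q" and "x \<equiv> fps_const q"
  shows depth_gf_1: "depth_gf q 1 = fps_X * x * t ^ 2 * T ^ 2"
    and depth_gf_Suc_Suc: "depth_gf q (Suc (Suc d)) = fps_X * t * T * (T + x * t) * depth_gf q (Suc d)"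
proof -
  let ?z = "fps_X :: 'a fps"
  have T: "T = 1 + ?z * T ^ 3" using nc_gf_eq[of "1::'a"] by (simp add: T_def)
  have t: "t = 1 + (x * ?z) * t ^ 3" using nc_gf_eq[of q] by (simp add: t_def x_def)
  have D: "depth_gf q (Suc d) = T * (?z * x * T * t * mirror_depth_gf q d + (if d = 0 then 0 else ?z * x * t ^ 2 * depth_gf q d))"
    for d
    by (rule geometric_solution[OF T], subst depth_gf_Suc)
      (simp add: T_def t_def x_def algebra_simps)
  have L: "mirror_depth_gf q (Suc d) = t * (?z * T * t * depth_gf q d + (if d = 0 then 0 else ?z * T ^ 2 * mirror_depth_gf q d))"
    for d
    by (rule geometric_solution[OF t], subst mirror_depth_gf_Suc)
      (simp add: T_def t_def x_def algebra_simps)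
  show 1: "depth_gf q 1 = fps_X * x * t ^ 2 * T ^ 2"
    using D[of 0] by (simp add: mirror_depth_gf_0 power2_eq_square mult_ac flip: t_def)
  have L1: "mirror_depth_gf q 1 = fps_X * t ^ 2 * T ^ 2"
    using L[of 0] by (simp add: depth_gf_0 power2_eq_square mult_ac flip: T_def)
  \<comment> \<open>Rotating the polygon by one step sends the pair of nodes \<open>0\<close>, \<open>v\<close> to \<open>n\<close>, \<open>v - 1\<close>; this is the
      reason why the two families agree up to the factor \<open>x\<close>. It collapses the two coupled
      recurrences into a single one.\<close>
  have eq: "depth_gf q (Suc d) = x * mirror_depth_gf q (Suc d)" for d
  proof (induction d)
    case 0
    show ?case using 1 L1 by (simp add: mult_ac)
  next
    case (Suc d)
    show ?case
      unfolding D[of "Suc d"] L[of "Suc d"] using Suc.IH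
      by (simp add: algebra_simps power2_eq_square)
  qed
  show "depth_gf q (Suc (Suc d)) = fps_X * t * T * (T + x * t) * depth_gf q (Suc d)"
    unfolding D[of "Suc d"] using eq[of d] by (simp add: algebra_simps power2_eq_square)
qed

lemma depth_gf_nth_nth:
  assumes "r \<le> n"
  shows "depth_gf (fps_X :: 'a :: comm_ring_1 fps) d $ n $ r = 
    of_nat (card {E \<in> noncrossing_trees n. depth n E r = d})"
proof -
  have "depth_gf (fps_X :: 'a fps) d $ n $ r = 
      (\<Sum>E\<in>noncrossing_trees n. if depth n E r = d then 1 else 0)"
    unfolding depth_gf_def fps_nth_Abs_fps depth_sum_def fps_sum_nth
    using assms by (intro sum.cong refl) (simp add: fps_X_power_nth sum.delta sum.If_cases Int_def)
  also have "\<dots> = of_nat (card {E \<in> noncrossing_trees n. depth n E r = d})"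
    by (simp add: sum.If_cases Int_def)
  finally show ?thesis .
qed

section \<open>The coefficients of powers of T\<close>

lemma cubic_power_step:
  fixes F :: "'a :: comm_ring_1 fps"
  assumes F: "F = 1 + fps_X * F ^ 3"
  shows "F ^ m $ 0 = 1"
    and "F ^ Suc m $ Suc n = F ^ m $ Suc n + F ^ (m + 3) $ n"
proof -
  have "F $ 0 = 1" by (subst F) simp
  thus "F ^ m $ 0 = 1" by (simp add: fps_nth_power_0)
  have "F ^ Suc m = F ^ m * (1 + fps_X * F ^ 3)" using F by (metis power_Suc2)
  also have "\<dots> = F ^ m + fps_X * F ^ (m + 3)" by (simp add: algebra_simps power_add)
  finally have "F ^ Suc m $ Suc n = (F ^ m + fps_X * F ^ (m + 3)) $ Suc n" by (rule arg_cong)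
  thus "F ^ Suc m $ Suc n = F ^ m $ Suc n + F ^ (m + 3) $ n" by simp
qed

lemma fuss_catalan_step:
  fixes k m :: nat
  defines "N \<equiv> 3 * k + m + 5"
  shows "(real m + 1) * real (Suc N choose Suc k) / (real k + 2) = 
    real m * real (N choose Suc k) / (real k + 2) + (real m + 3) * real (N choose k) / (real k + 1)"
proof -
  have "Suc k * (N choose Suc k) = (N - k) * (N choose k)"
    by (simp only: binomial_absorb_comp binomial_absorption)
  hence "real (Suc k) * real (N choose Suc k) = real (N - k) * real (N choose k)"
    by (metis of_nat_mult)
  hence step: "real (N choose Suc k) = (2 * real k + real m + 5) * real (N choose k) / (real k + 1)"
    by (simp add: N_def field_simps of_nat_diff)
  show ?thesis
    unfolding binomial_Suc_Suc of_nat_add step by (simp add: divide_simps) (simp add: algebra_simps)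
qed

text \<open>Multiplying \<open>F = 1 + z F^3\<close> by \<open>F^m\<close> gives a recurrence for the coefficients of the powers of \<open>F\<close> that
determines them, so it is enough to verify it for the Fuss-Catalan numbers. These are written here
in a form that stays meaningful for \<open>m = 0\<close>.\<close>

lemma cubic_power_nth:
  fixes F :: "real fps"
  assumes F: "F = 1 + fps_X * F ^ 3"
  shows "F ^ m $ Suc n = real m * real ((3 * n + m + 2) choose n) / real (Suc n)"
proof (induction n arbitrary: m)
  case 0
  show ?case
  proof (induction m)
    case (Suc m)
    thus ?case unfolding cubic_power_step(2)[OF F] by (simp add: cubic_power_step(1)[OF F])
  qed simp
next
  case (Suc k)
  note outer = Suc.IH
  show ?case
  proof (induction m)
    case (Suc m)
    show ?case
      unfolding cubic_power_step(2)[OF F] Suc.IH outer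
      using fuss_catalan_step[of m k] by (simp add: add_ac eval_nat_numeral)
  qed simp
qed

lemma cubic_solution_eq_T_series:
  fixes F :: "real fps"
  assumes F: "F = 1 + fps_X * F ^ 3"
  shows "F = T_series"
proof (rule fps_eqI_Suc)
  show "F $ 0 = T_series $ 0" 
    using cubic_power_step(1)[OF F, of 1] by (simp add: T_series_def)
  fix n
  have "Suc n * ((3 * n + 3) choose Suc n) = (3 * n + 3 - n) * ((3 * n + 3) choose n)"
    by (simp only: binomial_absorb_comp binomial_absorption)
  also have "3 * n + 3 - n = 2 * n + 3" by simp
  finally have "real (Suc n) * real ((3 * n + 3) choose Suc n) = real (2 * n + 3) * real ((3 * n + 3) choose n)"
    by (metis of_nat_mult)
  hence "real ((3 * n + 3) choose n) / real (Suc n) = real ((3 * n + 3) choose Suc n) / real (2 * n + 3)"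
    by (simp add: field_simps)
  moreover have "3 * n + 1 + 2 = 3 * n + (3 :: nat)" by simp
  hence "F $ Suc n = real ((3 * n + 3) choose n) / real (Suc n)"
    using cubic_power_nth[OF F, of 1 n] by (simp only: power_one_right)
  ultimately show "F $ Suc n = T_series $ Suc n"
    by (simp add: T_series_def add_ac)
qed

lemma nc_gf_1_cubic: "(nc_gf 1 :: real fps) = 1 + fps_X * nc_gf 1 ^ 3"
  using nc_gf_eq[of "1 :: real"] by simp

lemma nc_gf_1_eq_T_series: "(nc_gf 1 :: real fps) = T_series"
  by (rule cubic_solution_eq_T_series[OF nc_gf_1_cubic])

lemma T_series_cubic: "(T_series :: real fps) = 1 + fps_X * T_series ^ 3"
  using nc_gf_1_cubic unfolding nc_gf_1_eq_T_series .

lemma card_noncrossing_trees: "real (card (noncrossing_trees n)) = T_series $ n"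
  unfolding nc_gf_1_eq_T_series[symmetric] by (simp add: nc_gf_def)

lemma T_series_pos: "(T_series :: real fps) $ n > 0"
  by (simp add: T_series_def)

section \<open>Limits of coefficient ratios as dual numbers\<close>

lemma T_power_ratio:
  "(\<lambda>n. (T_series :: real fps) ^ m $ n / T_series $ n) \<longlonglongrightarrow> real m * (3 / 2) ^ (m - 1)"
proof (cases m)
  case 0
  have "(\<lambda>n. (T_series :: real fps) ^ m $ Suc n / T_series $ Suc n) \<longlonglongrightarrow> 0"
    by (simp add: 0)
  from LIMSEQ_imp_Suc[OF this] show ?thesis by (simp add: 0)
next
  case (Suc i)
  have "(\<lambda>n. real ((3 * n + 3 + i) choose n) / real ((3 * n + 3) choose n)) \<longlonglongrightarrow> (3 / 2) ^ i"
  proof (induction i)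
    case (Suc i)
    have "(\<lambda>n. (3 * real n + 4 + real i) / (2 * real n + 4 + real i)) \<longlonglongrightarrow> 3 / 2" 
      by real_asymp
    from tendsto_mult[OF this Suc.IH]
    have "(\<lambda>n. (3 * real n + 4 + real i) / (2 * real n + 4 + real i) * 
        (real ((3 * n + 3 + i) choose n) / real ((3 * n + 3) choose n))) \<longlonglongrightarrow> (3 / 2) ^ Suc i"
      by simp
    moreover have "(3 * real n + 4 + real i) / (2 * real n + 4 + real i) * 
        (real ((3 * n + 3 + i) choose n) / real ((3 * n + 3) choose n)) =
        real ((3 * n + 3 + Suc i) choose n) / real ((3 * n + 3) choose n)" for n
    proof -
      have "3 * n + 3 + Suc i - n = 2 * n + 4 + i" "3 * n + 3 + Suc i - 1 = 3 * n + 3 + i" by simp_all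
      hence "(2 * n + 4 + i) * ((3 * n + 3 + Suc i) choose n) = 
          (3 * n + 3 + Suc i) * ((3 * n + 3 + i) choose n)"
        using binomial_absorb_comp[of "3 * n + 3 + Suc i" n] by (simp only:)
      hence "real (2 * n + 4 + i) * real ((3 * n + 3 + Suc i) choose n) = 
          real (3 * n + 3 + Suc i) * real ((3 * n + 3 + i) choose n)"
        by (metis of_nat_mult)
      moreover have "real (2 * n + 4 + i) > 0" by linarith
      ultimately have "real ((3 * n + 3 + Suc i) choose n) = 
          real (3 * n + 3 + Suc i) * real ((3 * n + 3 + i) choose n) / real (2 * n + 4 + i)"
        by (simp add: nonzero_eq_divide_eq mult.commute)
      thus ?thesis by simp
    qed
    ultimately show ?case by simp
  qed simp
  hence "(\<lambda>n. real m * (real ((3 * n + 3 + i) choose n) / real ((3 * n + 3) choose n))) 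
      \<longlonglongrightarrow> real m * (3 / 2) ^ i"
    by (rule tendsto_mult_left)
  moreover have "real m * (real ((3 * n + 3 + i) choose n) / real ((3 * n + 3) choose n)) =
      T_series ^ m $ Suc n / T_series $ Suc n" for n
    using cubic_power_nth[OF T_series_cubic, of m n] cubic_power_nth[OF T_series_cubic, of 1 n]
    by (simp add: Suc add_ac eval_nat_numeral)
  ultimately have "(\<lambda>n. (T_series :: real fps) ^ m $ Suc n / T_series $ Suc n) \<longlonglongrightarrow> real m * (3 / 2) ^ i"
    by simp
  from LIMSEQ_imp_Suc[OF this] show ?thesis by (simp add: Suc)
qed

lemma T_shift_ratio:
  "(\<lambda>n. (T_series :: real fps) $ n / T_series $ Suc n) \<longlonglongrightarrow> 4 / 27"
proof -
  \<comment> \<open>The cubic equation reduces the shift to the ratio for the cube.\<close>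
  have "(T_series :: real fps) $ Suc n = T_series ^ 3 $ n" for n
    by (subst T_series_cubic) simp
  moreover have "(\<lambda>n. inverse ((T_series :: real fps) ^ 3 $ n / T_series $ n)) \<longlonglongrightarrow> 
      inverse (real 3 * (3 / 2) ^ (3 - 1))"
    by (intro tendsto_inverse T_power_ratio) simp
  ultimately show ?thesis by (simp add: power2_eq_square)
qed

text \<open>The series \<open>f\<close> is a polynomial in \<open>z\<close> and \<open>T(z)\<close> whose value at \<open>z = 4/27\<close>, \<open>T = 3/2 + \<epsilon>\<close>, where
\<open>\<epsilon>^2 = 0\<close>, is \<open>a + b \<epsilon>\<close>. A relation between the series and its dual number avoids any choice of the
polynomial.\<close>

inductive dual_value :: "real fps \<Rightarrow> real \<Rightarrow> real \<Rightarrow> bool" where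
  monomial: "dual_value (fps_X ^ k * T_series ^ m) ((4 / 27) ^ k * (3 / 2) ^ m) 
               ((4 / 27) ^ k * (real m * (3 / 2) ^ (m - 1)))"
| add: "dual_value f a b \<Longrightarrow> dual_value g a' b' \<Longrightarrow> dual_value (f + g) (a + a') (b + b')"
| scale: "dual_value f a b \<Longrightarrow> dual_value (fps_const c * f) (c * a) (c * b)"

text \<open>The \<open>\<epsilon>\<close>-part is linear in the series, so it suffices to know the limit for monomials.\<close>

lemma dual_value_tendsto:
  assumes "dual_value f a b"
  shows "(\<lambda>n. f $ n / T_series $ n) \<longlonglongrightarrow> b"
  using assms
proof induction
  case (monomial k m)
  show ?case
  proof (induction k)
    case 0
    show ?case using T_power_ratio[of m] by simp
  next
    case (Suc k)
    define f where "f = fps_X ^ k * (T_series :: real fps) ^ m"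
    have "(\<lambda>n. (f $ n / T_series $ n) * (T_series $ n / T_series $ Suc n)) \<longlonglongrightarrow> 
        (4 / 27) ^ k * (real m * (3 / 2) ^ (m - 1)) * (4 / 27)"
      using tendsto_mult[OF Suc.IH T_shift_ratio] by (simp add: f_def)
    also have "(\<lambda>n. (f $ n / T_series $ n) * (T_series $ n / T_series $ Suc n)) =
        (\<lambda>n. (fps_X * f) $ Suc n / T_series $ Suc n)"
    proof
      fix n show "(f $ n / T_series $ n) * (T_series $ n / T_series $ Suc n) = 
          (fps_X * f) $ Suc n / T_series $ Suc n"
        using T_series_pos[of n] by simp
    qed
    finally have "(\<lambda>n. (fps_X * f) $ n / T_series $ n) \<longlonglongrightarrow> 
        (4 / 27) ^ k * (real m * (3 / 2) ^ (m - 1)) * (4 / 27)"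
      by (rule LIMSEQ_imp_Suc)
    moreover have "fps_X ^ Suc k * T_series ^ m = fps_X * f" by (simp add: f_def mult_ac)
    moreover have "(4 / 27) ^ k * (real m * (3 / 2) ^ (m - 1)) * (4 / 27) = 
        (4 / 27) ^ Suc k * (real m * (3 / 2) ^ (m - 1))" by simp
    ultimately show ?case by (simp only:)
  qed
next
  case (add f a b g a' b')
  thus ?case using tendsto_add by (simp add: add_divide_distrib)
next
  case (scale f a b c)
  thus ?case using tendsto_mult_left[of "\<lambda>n. f $ n / T_series $ n" b sequentially c] by simp
qed

lemma dual_value_cong: 
  "dual_value f a b \<Longrightarrow> f = f' \<Longrightarrow> a = a' \<Longrightarrow> b = b' \<Longrightarrow> dual_value f' a' b'"
  by simp

lemma dual_value_const: "dual_value (fps_const c) c 0"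
  using dual_value.scale[OF dual_value.monomial[of 0 0], of c] by simp

lemma dual_value_X_power: "dual_value (fps_X ^ k) ((4 / 27) ^ k) 0"
  using dual_value.monomial[of k 0] by simp

lemma dual_value_T: "dual_value T_series (3 / 2) 1"
  using dual_value.monomial[of 0 1] by simp

text \<open>This is where the dual numbers pay off: limits of ratios for a product of series follow from those
for the factors without any estimate of a convolution.\<close>

lemma dual_value_mult:
  assumes "dual_value f a b" "dual_value g a' b'"
  shows "dual_value (f * g) (a * a') (a * b' + b * a')"
  using assms
proof (induction arbitrary: g a' b')
  case (monomial k m)
  from monomial show ?case
  proof (induction)
    case (monomial k' m')
    show ?case
      by (rule dual_value_cong[OF dual_value.monomial[of "k + k'" "m + m'"]])
        (cases m; cases m'; simp add: power_add algebra_simps)+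
  next
    case (add f a b g a' b')
    show ?case
      by (rule dual_value_cong[OF dual_value.add[OF add.IH]]) (simp_all add: algebra_simps)
  next
    case (scale f a b c)
    show ?case
      by (rule dual_value_cong[OF dual_value.scale[OF scale.IH, of c]]) (simp_all add: algebra_simps)
  qed
next
  case (add f a b h a1 b1)
  show ?case
    by (rule dual_value_cong[OF dual_value.add[OF add.IH(1)[OF add.prems] add.IH(2)[OF add.prems]]])
      (simp_all add: algebra_simps)
next
  case (scale f a b c)
  show ?case
    by (rule dual_value_cong[OF dual_value.scale[OF scale.IH[OF scale.prems], of c]]) 
      (simp_all add: algebra_simps)
qed

lemma dual_value_sum:
  assumes "\<And>i. i \<in> I \<Longrightarrow> dual_value (f i) (a i) (b i)"
  shows "dual_value (\<Sum>i\<in>I. f i) (\<Sum>i\<in>I. a i) (\<Sum>i\<in>I. b i)"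
  using assms
proof (induction I rule: infinite_finite_induct)
  case (insert x F)
  thus ?case by (simp add: dual_value.add)
qed (use dual_value_const[of 0] in simp_all)

text \<open>The coefficient of \<open>x^r\<close>, as a series in \<open>z\<close>. The bivariate series are series in \<open>z\<close> over the series in
\<open>x\<close>, because counting by the number of edges produces them in this form.\<close>

definition column :: "'a :: comm_ring_1 fps fps \<Rightarrow> nat \<Rightarrow> 'a fps" where
  "column F r = Abs_fps (\<lambda>n. F $ n $ r)"

lemma column_add: "column (F + G) r = column F r + column G r"
  by (simp add: column_def fps_eq_iff)

lemma column_mult: "column (F * G) r = (\<Sum>i=0..r. column F i * column G (r - i))"
proof (rule fps_ext)
  fix n
  have "column (F * G) r $ n = (\<Sum>k=0..n. \<Sum>i=0..r. F $ k $ i * G $ (n - k) $ (r - i))"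
    by (simp add: column_def fps_mult_nth fps_sum_nth)
  also have "\<dots> = (\<Sum>i=0..r. \<Sum>k=0..n. F $ k $ i * G $ (n - k) $ (r - i))"
    by (rule sum.swap)
  also have "\<dots> = (\<Sum>i=0..r. column F i * column G (r - i)) $ n"
    by (simp add: column_def fps_mult_nth fps_sum_nth)
  finally show "column (F * G) r $ n = (\<Sum>i=0..r. column F i * column G (r - i)) $ n" .
qed

definition dual_series :: "real fps fps \<Rightarrow> real fps \<Rightarrow> real fps \<Rightarrow> bool" where
  "dual_series F A B \<longleftrightarrow> (\<forall>r. dual_value (column F r) (A $ r) (B $ r))"

lemma dual_series_add:
  "dual_series F A B \<Longrightarrow> dual_series G A' B' \<Longrightarrow> dual_series (F + G) (A + A') (B + B')"
  by (simp add: dual_series_def column_add dual_value.add)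

lemma dual_series_mult:
  assumes "dual_series F A B" "dual_series G A' B'"
  shows "dual_series (F * G) (A * A') (A * B' + B * A')"
  unfolding dual_series_def
proof
  fix r
  have "dual_value (\<Sum>i=0..r. column F i * column G (r - i)) 
      (\<Sum>i=0..r. A $ i * A' $ (r - i)) (\<Sum>i=0..r. A $ i * B' $ (r - i) + B $ i * A' $ (r - i))"
    using assms by (intro dual_value_sum dual_value_mult) (auto simp: dual_series_def)
  thus "dual_value (column (F * G) r) ((A * A') $ r) ((A * B' + B * A') $ r)"
    by (simp add: column_mult fps_mult_nth sum.distrib)
qed

lemma dual_series_z: "dual_series fps_X (fps_const (4 / 27)) 0"
proof -
  have "column fps_X r = (if r = 0 then fps_X else 0 :: real fps)" for r
    by (auto simp: column_def fps_eq_iff fps_X_def)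
  thus ?thesis
    using dual_value_X_power[of 1] dual_value_const[of 0] by (simp add: dual_series_def)
qed

lemma dual_series_x: "dual_series (fps_const fps_X) fps_X 0"
proof -
  have "column (fps_const fps_X) r = fps_const (if r = 1 then 1 else 0 :: real)" for r
    by (auto simp: column_def fps_eq_iff fps_X_def)
  thus ?thesis
    using dual_value_const by (simp add: dual_series_def fps_X_def)
qed

lemma dual_series_T: "dual_series (nc_gf 1) (fps_const (3 / 2)) 1"
proof -
  have "column (nc_gf 1) r = (if r = 0 then T_series else 0 :: real fps)" for r
    by (auto simp: column_def fps_eq_iff nc_gf_def card_noncrossing_trees fps_of_nat[symmetric])
  thus ?thesis
    using dual_value_T dual_value_const[of 0] by (simp add: dual_series_def)
qed

lemma dual_series_t: "dual_series (nc_gf fps_X) (nc_gf (4 / 27)) 0"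
  unfolding dual_series_def
proof
  fix r
  have "column (nc_gf fps_X) r = fps_const (T_series $ r :: real) * fps_X ^ r"
    by (auto simp: column_def fps_eq_iff nc_gf_def fps_X_power_nth card_noncrossing_trees 
      fps_of_nat[symmetric])
  thus "dual_value (column (nc_gf fps_X) r) (nc_gf (4 / 27) $ r) (0 $ r)"
    using dual_value.scale[OF dual_value_X_power[of r], of "T_series $ r"] by (simp add: nc_gf_def card_noncrossing_trees)
qed


text \<open>The series \<open>T(4x/27)\<close>, which is the value of \<open>T(z x)\<close> at the singularity. Its \<open>\<epsilon>\<close>-part vanishes because
the coefficient of \<open>x^r\<close> in \<open>T(z x)\<close> is a multiple of \<open>z^r\<close>.\<close>

abbreviation crit_t :: "real fps" where
  "crit_t \<equiv> nc_gf (4 / 27)"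

text \<open>Value and slope of the factor \<open>z t T (T + x t)\<close> by which the series grows from one depth to the
next.\<close>

definition step_value :: "real fps" where
  "step_value = fps_const (2 / 9) * crit_t * (fps_const (3 / 2) + fps_X * crit_t)"

definition step_slope :: "real fps" where
  "step_slope = fps_const (4 / 27) * crit_t * (fps_const 3 + fps_X * crit_t)"

text \<open>Value and slope of the series for depth \<open>d\<close>. For \<open>d = 0\<close> both are replaced by \<open>0\<close>: the only node of depth
\<open>0\<close> is the root, which is excluded by \<open>r \<ge> 1\<close>, and the factor \<open>x\<close> in the series for positive depth
makes the coefficient of \<open>x^0\<close> vanish as well.\<close>

primrec crit_value :: "nat \<Rightarrow> real fps" where
  "crit_value 0 = 0"
| "crit_value (Suc d) = step_value * crit_value d + (if d = 0 then fps_const (1 / 3) * fps_X * crit_t ^ 2 else 0)"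

primrec crit_slope :: "nat \<Rightarrow> real fps" where
  "crit_slope 0 = 0"
| "crit_slope (Suc d) = step_value * crit_slope d + step_slope * crit_value d 
     + (if d = 0 then fps_const (4 / 9) * fps_X * crit_t ^ 2 else 0)"

lemma dual_series_cong: 
  "dual_series f a b \<Longrightarrow> f = f' \<Longrightarrow> a = a' \<Longrightarrow> b = b' \<Longrightarrow> dual_series f' a' b'"
  by simp

lemma dual_series_step:
  "dual_series (fps_X * nc_gf fps_X * nc_gf 1 * (nc_gf 1 + fps_const fps_X * nc_gf fps_X)) 
     step_value step_slope"
proof -
  have c: "fps_const (2 / 9 :: real) = fps_const (4 / 27) * fps_const (3 / 2)"
      "fps_const (3 :: real) = fps_const (3 / 2) + fps_const (3 / 2)"
    by simp_all
  show ?thesis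
    by (rule dual_series_cong[OF dual_series_mult[OF dual_series_mult[OF 
          dual_series_mult[OF dual_series_z dual_series_t] dual_series_T]
          dual_series_add[OF dual_series_T dual_series_mult[OF dual_series_x dual_series_t]]]])
      (simp_all add: step_value_def step_slope_def c algebra_simps del: fps_const_mult fps_const_add)
qed

lemma dual_series_depth_gf: 
  "dual_series (depth_gf fps_X (Suc d)) (crit_value (Suc d)) (crit_slope (Suc d))"
proof (induction d)
  case 0
  have c: "fps_const (1 / 3 :: real) = fps_const (4 / 27) * (fps_const (3 / 2) * fps_const (3 / 2))"
      "fps_const (4 / 9 :: real) = fps_const (4 / 27) * (fps_const (3 / 2) + fps_const (3 / 2))"
    by simp_all
  show ?case
    by (rule dual_series_cong[OF dual_series_mult[OF dual_series_mult[OF dual_series_mult[OF 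
          dual_series_z dual_series_x] dual_series_mult[OF dual_series_t dual_series_t]]
          dual_series_mult[OF dual_series_T dual_series_T]]])
      (simp_all add: c depth_gf_1[simplified] power2_eq_square algebra_simps 
        del: fps_const_mult fps_const_add)
next
  case (Suc d)
  show ?case
    by (rule dual_series_cong[OF dual_series_mult[OF dual_series_step Suc.IH]])
      (simp_all add: depth_gf_Suc_Suc crit_value.simps(2)[of "Suc d"] crit_slope.simps(2)[of "Suc d"]
        del: crit_value.simps crit_slope.simps)
qed

lemma dual_series_tendsto:
  assumes "dual_series F A B"
  shows "(\<lambda>n. F $ n $ r / T_series $ n) \<longlonglongrightarrow> B $ r"
  using assms dual_value_tendsto[of "column F r" "A $ r" "B $ r"] by (simp add: dual_series_def column_def)

lemma depth_prob_eq:
  assumes "r \<le> n"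
  shows "depth_prob n r d = depth_gf fps_X d $ n $ r / T_series $ n"
proof -
  have "card (noncrossing_trees n) > 0"
    using T_series_pos[of n] by (simp flip: card_noncrossing_trees)
  hence "noncrossing_trees n \<noteq> {}" by auto
  thus ?thesis
    unfolding depth_prob_def by (simp add: measure_pmf_of_set depth_gf_nth_nth[OF assms] Int_def 
      flip: card_noncrossing_trees)
qed

theorem depth_prob_tendsto:
  assumes "r \<ge> 1"
  shows "(\<lambda>n. depth_prob n r d) \<longlonglongrightarrow> crit_slope d $ r"
proof -
  have "(\<lambda>n. depth_gf fps_X d $ n $ r / T_series $ n) \<longlonglongrightarrow> crit_slope d $ r"
  proof (cases d)
    case 0
    have "depth_gf (fps_X :: real fps) 0 $ n $ r = 0" for n
      using assms by (simp add: depth_gf_0 nc_gf_def flip: fps_of_nat)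
    thus ?thesis by (simp add: 0)
  next
    case (Suc d')
    thus ?thesis using dual_series_tendsto[OF dual_series_depth_gf] by simp
  qed
  moreover have "\<forall>\<^sub>F n in sequentially. depth_gf fps_X d $ n $ r / T_series $ n = depth_prob n r d"
    using eventually_ge_at_top[of r] by eventually_elim (simp add: depth_prob_eq)
  ultimately show ?thesis by (rule Lim_transform_eventually)
qed

lemma crit_slope_0: "crit_slope d $ 0 = 0"
proof -
  have "crit_value d $ 0 = 0" for d by (induction d) simp_all
  thus ?thesis by (induction d) simp_all
qed

section \<open>Rationalising the denominator\<close>

text \<open>The difference of the two sides is divisible by \<open>4 x t^3 - 27 (t - 1)\<close>; the quotient is the result of
polynomial division with respect to \<open>t\<close>. The polynomial \<open>B\<close> is \<open>9\<close> times the base of the denominator before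
rationalisation, \<open>D\<close> is twice the base of the final one, and \<open>N2\<close> is \<open>9\<close> times the coefficient of \<open>t^2\<close>;
in this way no fractions occur and the identity holds in every integral domain.\<close>

lemma rationalised_form:
  fixes x y t :: "'a :: idom"
  assumes t: "4 * x * t ^ 3 = 27 * (t - 1)"
  defines "B \<equiv> 9 - 3 * y * t - 2 * x * y * t ^ 2"
    and "D \<equiv> y ^ 2 * (3 - y) - x * (4 - 12 * y + 15 * y ^ 2 - 3 * y ^ 3) + 2 * x ^ 2 * y ^ 3"
    and "N2 \<equiv> x ^ 2 * y * (1 - y) * (12 * y ^ 2 - 5 * y ^ 3 + y ^ 4 
      + x * (16 - 44 * y + 36 * y ^ 2 - 27 * y ^ 3 + 3 * y ^ 4) + 4 * x ^ 2 * y ^ 3 * (1 + y))"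
    and "N1 \<equiv> x ^ 2 * y ^ 2 * (1 - y) ^ 2 * (2 - y) * (4 - y - x * (2 + y))"
    and "N0 \<equiv> x * y ^ 2 * (1 - x * y) * (y ^ 3 - x * (8 - 18 * y + 12 * y ^ 2) + x ^ 2 * y ^ 3)"
  shows "9 * (4 * x * y * t ^ 2 * (9 - x * y * t ^ 2)) * D ^ 2 = 
    4 * (N2 * t ^ 2 + 9 * N1 * t + 9 * N0) * B ^ 2"
proof -
  have "9 * (4 * x * y * t ^ 2 * (9 - x * y * t ^ 2)) * D ^ 2 - 
      4 * (N2 * t ^ 2 + 9 * N1 * t + 9 * N0) * B ^ 2 = (4 * x * t ^ 3 - 27 * (t - 1)) *
     (- 108*x*y^5 - 108*x*y^5*t + 72*x*y^6*t + 864*x^2*y^2 - 1944*x^2*y^3 - 144*x^2*y^3*t +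
      1296*x^2*y^4 + 324*x^2*y^4*t - 144*x^2*y^5*t^2 + 108*x^2*y^6 + 204*x^2*y^6*t^2 -
      72*x^2*y^7*t - 72*x^2*y^7*t^2 + 12*x^2*y^8*t^2 + 432*x^3*y^2*t - 864*x^3*y^3 -
      1728*x^3*y^3*t - 192*x^3*y^3*t^2 + 1944*x^3*y^4 + 2844*x^3*y^4*t + 432*x^3*y^4*t^2 -
      1404*x^3*y^5 - 2484*x^3*y^5*t - 168*x^3*y^5*t^2 - 48*x^3*y^5*t^3 + 828*x^3*y^6*t +
      68*x^3*y^6*t^3 - 72*x^3*y^7*t^2 - 24*x^3*y^7*t^3 + 4*x^3*y^8*t^3 - 64*x^4*y^3*t^3 +
      144*x^4*y^4*t^2 + 240*x^4*y^4*t^3 - 288*x^4*y^5*t^2 - 320*x^4*y^5*t^3 + 108*x^4*y^6 +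
      108*x^4*y^6*t + 60*x^4*y^6*t^2 + 252*x^4*y^6*t^3 - 72*x^4*y^7*t + 72*x^4*y^7*t^2 -
      120*x^4*y^7*t^3 + 12*x^4*y^8*t^2 + 12*x^4*y^8*t^3 - 16*x^5*y^6*t^3 + 16*x^5*y^8*t^3)"
    unfolding B_def D_def N2_def N1_def N0_def by algebra
  thus ?thesis using t by simp
qed


section \<open>Summation over all depths\<close>

text \<open>A sequence of series in \<open>x\<close>, one for each power of \<open>y\<close>, read as a series in \<open>x\<close> over the Laurent
series in \<open>y\<close>. Linear recurrences in \<open>d\<close> become linear equations between such series, because
multiplication by a series in \<open>x\<close> acts on each term (\<open>series_in_xy_mult\<close>) and a shift of the index
is multiplication by \<open>y\<close> (\<open>series_in_xy_shift\<close>).\<close>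

definition series_in_xy :: "(nat \<Rightarrow> real fps) \<Rightarrow> real fls fps" where
  "series_in_xy S = Abs_fps (\<lambda>r. fps_to_fls (Abs_fps (\<lambda>d. S d $ r)))"

definition series_in_x :: "real fps \<Rightarrow> real fls fps" where
  "series_in_x w = Abs_fps (\<lambda>r. fls_const (w $ r))"

lemma series_in_xy_add: "series_in_xy (\<lambda>d. S d + S' d) = series_in_xy S + series_in_xy S'"
  by (rule fps_ext) (simp add: series_in_xy_def flip: fps_to_fls_plus, simp add: fps_eq_iff)

lemma series_in_xy_mult: "series_in_xy (\<lambda>d. w * S d) = series_in_x w * series_in_xy S"
proof (rule fps_ext)
  fix r
  have sum: "fps_to_fls (\<Sum>i\<in>I. f i) = (\<Sum>i\<in>I. fps_to_fls (f i))" 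
    for f :: "nat \<Rightarrow> real fps" and I
    by (induction I rule: infinite_finite_induct) auto
  have "series_in_xy (\<lambda>d. w * S d) $ r = 
      fps_to_fls (\<Sum>i=0..r. fps_const (w $ i) * Abs_fps (\<lambda>d. S d $ (r - i)))"
    unfolding series_in_xy_def fps_nth_Abs_fps
    by (intro arg_cong[of _ _ fps_to_fls] fps_ext) (simp add: fps_mult_nth[of w] fps_sum_nth)
  also have "\<dots> = (series_in_x w * series_in_xy S) $ r"
    by (simp add: sum fls_times_fps_to_fls fps_mult_nth series_in_xy_def series_in_x_def)
  finally show "series_in_xy (\<lambda>d. w * S d) $ r = (series_in_x w * series_in_xy S) $ r" .
qed

lemma series_in_xy_single: "series_in_xy (\<lambda>d. if d = 0 then w else 0) = series_in_x w"
proof (rule fps_ext)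
  fix r
  have "Abs_fps (\<lambda>d. (if d = 0 then w else 0) $ r) = fps_const (w $ r)"
    by (rule fps_ext) simp
  thus "series_in_xy (\<lambda>d. if d = 0 then w else 0) $ r = series_in_x w $ r"
    by (simp add: series_in_xy_def series_in_x_def)
qed

lemma series_in_xy_shift:
  assumes "S 0 = 0"
  shows "series_in_xy S = var_y * series_in_xy (\<lambda>d. S (Suc d))"
proof (rule fps_ext)
  fix r
  have "Abs_fps (\<lambda>d. S d $ r) = fps_X * Abs_fps (\<lambda>d. S (Suc d) $ r)"
    by (rule fps_ext) (use assms in \<open>simp add: gr0_conv_Suc\<close>)
  thus "series_in_xy S $ r = (var_y * series_in_xy (\<lambda>d. S (Suc d))) $ r"
    by (simp add: series_in_xy_def var_y_def fls_times_fps_to_fls)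
qed

lemma series_in_x_add: "series_in_x (v + w) = series_in_x v + series_in_x w"
  by (simp add: series_in_x_def fps_eq_iff fls_eq_iff)

lemma series_in_x_mult: "series_in_x (v * w) = series_in_x v * series_in_x w"
proof -
  have "series_in_x (v * w) = series_in_xy (\<lambda>d. v * (if d = 0 then w else 0))"
    unfolding series_in_xy_single[symmetric] by (rule arg_cong[of _ _ series_in_xy]) auto
  thus ?thesis by (simp only: series_in_xy_mult series_in_xy_single)
qed

lemma series_in_x_power: "series_in_x (w ^ n) = series_in_x w ^ n"
proof (induction n)
  case 0
  show ?case by (simp add: series_in_x_def fps_eq_iff)
qed (simp add: series_in_x_mult)

lemma series_in_x_const: "series_in_x (fps_const c) = fps_const (fls_const c)"
  by (simp add: series_in_x_def fps_eq_iff)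

lemma series_in_x_X: "series_in_x fps_X = var_x"
  by (simp add: series_in_x_def var_x_def fps_X_def fps_eq_iff)

lemma series_in_x_numeral: "series_in_x (numeral k) = numeral k"
  unfolding numeral_fps_const series_in_x_const fls_const_numeral ..

lemma numeral_mult_fps_const: "numeral k * fps_const c = fps_const (numeral k * c)"
  by (simp only: numeral_fps_const fps_const_mult)

lemma crit_t_cubic: "27 * crit_t = 27 + 4 * fps_X * crit_t ^ 3"
proof -
  have "27 * crit_t = 27 * (1 + fps_const (4 / 27) * fps_X * crit_t ^ 3)"
    using nc_gf_eq[of "4 / 27 :: real"] by (rule arg_cong)
  also have "\<dots> = 27 + (27 * fps_const (4 / 27)) * fps_X * crit_t ^ 3"
    by (simp only: distrib_left mult.assoc mult_1_right)
  also have "27 * fps_const (4 / 27 :: real) = 4"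
    unfolding numeral_mult_fps_const by (simp add: numeral_fps_const[symmetric])
  finally show ?thesis .
qed

lemma step_value_eq: "9 * step_value = 3 * crit_t + 2 * fps_X * crit_t ^ 2"
proof -
  have "9 * step_value = (9 * fps_const (2 / 9)) * fps_const (3 / 2) * crit_t 
      + (9 * fps_const (2 / 9)) * fps_X * crit_t ^ 2"
    unfolding step_value_def power2_eq_square distrib_left by (simp only: mult_ac)
  also have "9 * fps_const (2 / 9 :: real) = 2"
    unfolding numeral_mult_fps_const by (simp add: numeral_fps_const[symmetric])
  also have "2 * fps_const (3 / 2 :: real) = 3"
    unfolding numeral_mult_fps_const by (simp add: numeral_fps_const[symmetric])
  finally show ?thesis .
qed

lemma step_slope_eq: "27 * step_slope = 12 * crit_t + 4 * fps_X * crit_t ^ 2"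
proof -
  have "27 * step_slope = (27 * fps_const (4 / 27)) * fps_const 3 * crit_t 
      + (27 * fps_const (4 / 27)) * fps_X * crit_t ^ 2"
    unfolding step_slope_def power2_eq_square distrib_left by (simp only: mult_ac)
  also have "27 * fps_const (4 / 27 :: real) = 4"
    unfolding numeral_mult_fps_const by (simp add: numeral_fps_const[symmetric])
  also have "4 * fps_const (3 :: real) = 12"
    unfolding numeral_mult_fps_const by (simp add: numeral_fps_const[symmetric])
  finally show ?thesis .
qed

lemma critical_equations:
  defines "t \<equiv> series_in_x crit_t" and "x \<equiv> var_x" and "y \<equiv> var_y"
  shows series_in_x_crit_t_cubic: "4 * x * t ^ 3 = 27 * (t - 1)"
    and series_in_xy_crit_value: 
      "9 * series_in_xy crit_value = y * ((3 * t + 2 * x * t ^ 2) * series_in_xy crit_value + 3 * x * t ^ 2)"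
    and series_in_xy_crit_slope: 
      "27 * series_in_xy crit_slope = y * (3 * (3 * t + 2 * x * t ^ 2) * series_in_xy crit_slope 
            + (12 * t + 4 * x * t ^ 2) * series_in_xy crit_value + 12 * x * t ^ 2)"
proof -
  note emb = series_in_x_add series_in_x_mult series_in_x_power series_in_x_X series_in_x_numeral t_def[symmetric] x_def[symmetric]
  have "series_in_x (27 * crit_t) = series_in_x (27 + 4 * fps_X * crit_t ^ 3)"
    by (rule arg_cong[OF crit_t_cubic])
  thus "4 * x * t ^ 3 = 27 * (t - 1)"
    unfolding emb by (simp add: algebra_simps)
  have v: "9 * series_in_x step_value = 3 * t + 2 * x * t ^ 2"
    using arg_cong[OF step_value_eq, of series_in_x] unfolding emb .
  have s: "27 * series_in_x step_slope = 12 * t + 4 * x * t ^ 2"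
    using arg_cong[OF step_slope_eq, of series_in_x] unfolding emb .
  have "9 * fps_const (1 / 3 :: real) = 3" "27 * fps_const (4 / 9 :: real) = 12"
    unfolding numeral_mult_fps_const by (simp_all add: numeral_fps_const[symmetric])
  hence c: "9 * series_in_x (fps_const (1 / 3)) = 3" "27 * series_in_x (fps_const (4 / 9)) = 12"
    by (metis series_in_x_mult series_in_x_numeral)+
  define V G where "V = series_in_xy crit_value" and "G = series_in_xy crit_slope"
  have V: "V = y * (series_in_x step_value * V + series_in_x (fps_const (1 / 3)) * x * t ^ 2)"
    unfolding V_def y_def 
    by (subst series_in_xy_shift) (simp_all only: crit_value.simps series_in_xy_add series_in_xy_mult series_in_xy_single emb)
  have "9 * V = y * ((9 * series_in_x step_value) * V + (9 * series_in_x (fps_const (1 / 3))) * x * t ^ 2)"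
    by (subst V) (simp only: distrib_left mult_ac)
  thus "9 * series_in_xy crit_value = y * ((3 * t + 2 * x * t ^ 2) * series_in_xy crit_value + 3 * x * t ^ 2)"
    unfolding v c V_def .
  have G: "G = y * (series_in_x step_value * G + series_in_x step_slope * V + series_in_x (fps_const (4 / 9)) * x * t ^ 2)"
    unfolding G_def V_def y_def 
    by (subst series_in_xy_shift) (simp_all only: crit_slope.simps series_in_xy_add series_in_xy_mult series_in_xy_single emb)
  have "27 * G = y * (3 * (9 * series_in_x step_value) * G + (27 * series_in_x step_slope) * V 
      + (27 * series_in_x (fps_const (4 / 9))) * x * t ^ 2)"
    by (subst G) (simp add: algebra_simps)
  thus "27 * series_in_xy crit_slope = y * (3 * (3 * t + 2 * x * t ^ 2) * series_in_xy crit_slope 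
            + (12 * t + 4 * x * t ^ 2) * series_in_xy crit_value + 12 * x * t ^ 2)"
    unfolding v s c V_def G_def .
qed

text \<open>Eliminating \<open>V\<close>, which stands for the sum of the values, from the equation for the sum \<open>G\<close> of the
slopes. The factor \<open>3\<close> cannot be cancelled in characteristic \<open>3\<close>.\<close>

lemma limit_gf_eliminated:
  fixes x y t V G :: "'a :: idom"
  assumes "9 * V = y * ((3 * t + 2 * x * t ^ 2) * V + 3 * x * t ^ 2)"
    and "27 * G = y * (3 * (3 * t + 2 * x * t ^ 2) * G + (12 * t + 4 * x * t ^ 2) * V + 12 * x * t ^ 2)"
  defines "B \<equiv> 9 - 3 * y * t - 2 * x * y * t ^ 2"
  shows "3 * (B ^ 2 * G) = 3 * (4 * x * y * t ^ 2 * (9 - x * y * t ^ 2))"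
proof -
  have V: "B * V = 3 * x * y * t ^ 2"
    using assms(1) unfolding B_def by (simp add: algebra_simps)
  have "3 * (B * G) = y * (12 * t + 4 * x * t ^ 2) * V + 12 * x * y * t ^ 2"
    using assms(2) unfolding B_def by (simp add: algebra_simps)
  hence "B * (3 * (B * G)) = y * (12 * t + 4 * x * t ^ 2) * (B * V) + 12 * x * y * t ^ 2 * B"
    by (simp add: algebra_simps)
  also have "\<dots> = 3 * (4 * x * y * t ^ 2 * (9 - x * y * t ^ 2))"
    unfolding V unfolding B_def by algebra
  finally show ?thesis by (simp add: power2_eq_square mult_ac)
qed

lemma bivariate_gf_limit_prob: "bivariate_gf limit_prob = series_in_xy crit_slope"
proof (rule fps_ext)
  fix r
  have "limit_prob r = (\<lambda>d. crit_slope d $ r)" if "r \<ge> 1"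
    unfolding limit_prob_def using depth_prob_tendsto[OF that] by (intro ext limI)
  moreover have "Abs_fps (\<lambda>d. crit_slope d $ 0) = 0"
    by (simp add: crit_slope_0 fps_eq_iff)
  ultimately show "bivariate_gf limit_prob $ r = series_in_xy crit_slope $ r"
    by (cases "r = 0") (simp_all add: bivariate_gf_def series_in_xy_def)
qed

lemma T_compose_eq: "fps_compose T_series (fps_const (4 / 27) * var_x) = series_in_x crit_t"
proof (rule fps_ext)
  fix r
  have const: "(4 / 27 :: real fls) = fls_const (4 / 27)"
    by (simp flip: fls_const_divide_const)
  have "fps_compose T_series (fps_const (4 / 27) * var_x) $ r = T_series $ r * fls_const (4 / 27) ^ r"
    unfolding const[symmetric] var_x_def fps_compose_linear by simp
  also have "(T_series $ r :: real fls) = fls_const (T_series $ r)"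
    by (simp add: T_series_def fls_of_nat flip: fls_const_divide_const del: fls_const_divide_const)
  also have "fls_const (T_series $ r) * fls_const (4 / 27) ^ r = 
      fls_const (T_series $ r * (4 / 27 :: real) ^ r)"
    by (simp only: fls_const_mult_const[symmetric] fls_const_power)
  also have "\<dots> = series_in_x crit_t $ r"
    by (simp add: series_in_x_def nc_gf_def card_noncrossing_trees)
  finally show "fps_compose T_series (fps_const (4 / 27) * var_x) $ r = series_in_x crit_t $ r" .
qed

lemma fps_divide_numeral_cancel:
  fixes a :: "real fls fps"
  shows "numeral k * (a / numeral k) = a"
proof -
  have "is_unit (numeral k :: real fls fps)" by (simp add: fps_is_unit_iff)
  thus ?thesis by simp
qed

theorem theorem6p3:
  shows "(\<forall>r\<ge>1. \<forall>d. convergent (\<lambda>n. depth_prob n r d)) \<and>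
    (let x = var_x; y = var_y;
         t = fps_compose T_series (fps_const (4 / 27) * x)
     in bivariate_gf limit_prob =
          (P2 x y * t^2 + P1 x y * t + P0 x y) /
          (y^2 * (3 - y) / 2 - x / 2 * (4 - 12 * y + 15 * y^2 - 3 * y^3) + x^2 * y^3)^2)"
proof (intro conjI allI impI)
  show "convergent (\<lambda>n. depth_prob n r d)" if "r \<ge> 1" for r d
    using depth_prob_tendsto[OF that] by (auto simp: convergent_def)
next
  define x y t where "x = var_x" and "y = var_y" and "t = series_in_x crit_t"
  define G where "G = bivariate_gf limit_prob"
  define D where "D = y^2 * (3 - y) / 2 - x / 2 * (4 - 12 * y + 15 * y^2 - 3 * y^3) + x^2 * y^3"
  define N where "N = P2 x y * t^2 + P1 x y * t + P0 x y"
  define B where "B = 9 - 3 * y * t - 2 * x * y * t ^ 2"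
  have G: "3 * (B ^ 2 * G) = 3 * (4 * x * y * t ^ 2 * (9 - x * y * t ^ 2))"
    unfolding B_def G_def bivariate_gf_limit_prob x_def y_def t_def
    by (rule limit_gf_eliminated[OF series_in_xy_crit_value series_in_xy_crit_slope])
  have D2: "2 * D = y ^ 2 * (3 - y) - x * (4 - 12 * y + 15 * y ^ 2 - 3 * y ^ 3) + 2 * x ^ 2 * y ^ 3"
    unfolding D_def distrib_left right_diff_distrib mult.assoc[symmetric] fps_divide_numeral_cancel ..
  have cancel: "9 * (1 / 9 * a) = a" for a :: "real fls fps"
    unfolding mult.assoc[symmetric] fps_divide_numeral_cancel by simp
  have P2: "9 * P2 x y = x ^ 2 * y * (1 - y) * (12 * y ^ 2 - 5 * y ^ 3 + y ^ 4 
      + x * (16 - 44 * y + 36 * y ^ 2 - 27 * y ^ 3 + 3 * y ^ 4) + 4 * x ^ 2 * y ^ 3 * (1 + y))"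
    unfolding P2_def by (simp only: mult.assoc cancel)
  have N9: "9 * N = 9 * P2 x y * t ^ 2 + 9 * P1 x y * t + 9 * P0 x y"
    unfolding N_def by (simp only: distrib_left mult.assoc)
  have t: "4 * x * t ^ 3 = 27 * (t - 1)"
    unfolding x_def t_def by (rule series_in_x_crit_t_cubic)
  have "9 * (4 * x * y * t ^ 2 * (9 - x * y * t ^ 2)) * (2 * D) ^ 2 = 4 * (9 * N) * B ^ 2"
    unfolding D2 N9 P2 P1_def P0_def B_def by (rule rationalised_form[OF t])
  hence "3 * (9 * (4 * x * y * t ^ 2 * (9 - x * y * t ^ 2)) * (2 * D) ^ 2) = 3 * (4 * (9 * N) * B ^ 2)"
    by (rule arg_cong)
  \<comment> \<open>Here \<open>108 = 3 * 9 * 4\<close> collects the integer factors of the two identities.\<close>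
  hence "108 * B ^ 2 * (G * D ^ 2) = 108 * B ^ 2 * N"
    using G by algebra
  moreover have B0: "B $ 0 = 9 - 3 * fls_X"
    by (simp add: B_def x_def y_def t_def var_x_def var_y_def series_in_x_def nc_gf_def noncrossing_trees_0)
  have "fls_nth (9 - 3 * fls_X :: real fls) 0 = 9" by simp
  hence "B $ 0 \<noteq> 0" unfolding B0 by (metis fls_zero_nth zero_neq_numeral)
  hence "108 * B ^ 2 \<noteq> 0" by auto
  ultimately have GD: "G * D ^ 2 = N" by simp
  \<comment> \<open>The denominator is a unit because its constant term in \<open>x\<close> is a nonzero Laurent series.\<close>
  have "(2 * D) $ 0 = fls_X ^ 2 * (3 - fls_X)"
    unfolding D2 by (simp add: x_def y_def var_x_def var_y_def)
  moreover have "(fls_X ^ 2 * (3 - fls_X) :: real fls) \<noteq> 0"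
  proof -
    have "fls_nth (3 - fls_X :: real fls) 0 = 3" by simp
    hence "(3 - fls_X :: real fls) \<noteq> 0" by (metis fls_zero_nth zero_neq_numeral)
    thus ?thesis by simp
  qed
  ultimately have "D \<noteq> 0" by auto
  hence "G = N / D ^ 2" unfolding GD[symmetric] by simp
  thus "let x = var_x; y = var_y; t = fps_compose T_series (fps_const (4 / 27) * x)
     in bivariate_gf limit_prob =
          (P2 x y * t^2 + P1 x y * t + P0 x y) /
          (y^2 * (3 - y) / 2 - x / 2 * (4 - 12 * y + 15 * y^2 - 3 * y^3) + x^2 * y^3)^2"
    unfolding Let_def T_compose_eq G_def N_def D_def x_def y_def t_def .
qed

end
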